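(* For $X\in\{A,\Delta A\}$, the Coupled Projection Galerkin (CPG) operators $\widetilde N_{H,X},\widetilde V_{H,X},\widetilde B_{H,X}$ defined in the context satisfy $$\widetilde N_{H,X}+\widetilde N_{H,X}^{\top}=\widetilde B_{H,X}-\widetilde V_{H,X}.$$
   Context: Physical setting. Repeated spatial indices $k$ are summed over $1,\dots,d$ where no free index $k$ appears. The system is $\partial_tu+A_k(u)\partial_{x_k}u=0$, $u\in\mathbb R^m$ with values in an admissible set $\mathcal U$, $A_k=\partial_uF_k$ the Jacobian of a smooth flux. A smooth energy pair $(e,g_k)$ satisfies $\nabla_ue^\top A_k=\nabla_ug_k^\top$. On $\mathcal U$, $e>0$ and $\mathcal H_e=\nabla_u^2e$ is symmetric positive definite. Put $H(u)=\frac{2e(u)}{u^\top\mathcal H_e(u)u}\mathcal H_e(u)$. Let $G_k(u)$ be a smooth symmetric matrix field with $g_k=\tfrac12u^\top G_ku$, and define $\Delta A_k$ by $G_k=H(A_k+\Delta A_k)$. Discrete setting. $\Omega\subset\mathbb R^d$ is a (polytopal) element with outward unit normal $n$; $V^p$ is the space of polynomials of degree $\le p$ on $\Omega$, $N_p=\dim V^p$; $\{\phi_\alpha\}_{\alpha=1}^{N_p}$ is an $L^2$-orthonormal basis, $\Phi_\alpha=\phi_\alpha I_m$; $u_p\in(V^p)^m$ is the resolved state, with values in $\mathcal U$. $Q_{3p}$ is a volume quadrature on $\Omega$ exact for polynomials of degree $3p$; $Q_{3p+1}^{\partial\Omega}$ is a collection of face quadratures, each exact for polynomials of degree $3p+1$;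 for $n\ge3p+1$, $Q_{\mathrm{hi}(n)}$ is an $n$-exact volume quadrature. All have positive weights and act componentwise. $\Pi^{Q}_{L^2,q}f\in V^q$ denotes the discrete $L^2$ projection with quadrature $Q$: $Q[\phi(f-\Pi^Q_{L^2,q}f)]=0$ for all $\phi\in V^q$, applied componentwise to matrix fields (assumed well defined). CPG. For $X\in\{A,\Delta A\}$ and each $k$, let $Y_{X,k}(u_p)=H(u_p)X_k(u_p)$ and $Y_{X,k,p+1}:=\Pi^{Q_{\mathrm{hi}(n)}}_{L^2,p+1}[Y_{X,k}(u_p)]\in (V^{p+1})^{m\times m}$. Set $(\widetilde N_{H,X})_{\alpha\beta}=\sum_kQ_{3p}[\Phi_\alpha^\top Y_{X,k,p+1}\partial_{x_k}\Phi_\beta]$, $(\widetilde V_{H,X})_{\alpha\beta}=\sum_kQ_{3p}[\Phi_\alpha^\top(\partial_{x_k}Y_{X,k,p+1})\Phi_\beta]$, $(\widetilde B_{H,X})_{\alpha\beta}=\sum_kQ^{\partial\Omega}_{3p+1}[\Phi_\alpha^\top Y_{X,k,p+1}\Phi_\beta n_k]$. These are block matrices with $m\times m$ blocks and $(Z^\top)_{\alpha\beta}=(Z_{\beta\alpha})^\top$. *)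

theory Defs
  imports "HOL-Analysis.Analysis"
begin

section \<open>Differential operators\<close>

definition partial_deriv ::
    "'d::finite \<Rightarrow> (real^'d \<Rightarrow> 'v::real_normed_vector) \<Rightarrow> real^'d \<Rightarrow> 'v" where
  "partial_deriv k f x = frechet_derivative f (at x) (axis k 1)"

definition grad :: "(real^'m::finite \<Rightarrow> real) \<Rightarrow> real^'m \<Rightarrow> real^'m" where
  "grad f u = (\<chi> i. partial_deriv i f u)"

definition hessian :: "(real^'m::finite \<Rightarrow> real) \<Rightarrow> real^'m \<Rightarrow> real^'m^'m" where
  "hessian f u = jacobian (grad f) (at u)"

primrec times_differentiable_on ::
    "nat \<Rightarrow> ('a::real_normed_vector \<Rightarrow> 'b::real_normed_vector) \<Rightarrow> 'a set \<Rightarrow> bool" where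
  "times_differentiable_on 0 f S \<longleftrightarrow> continuous_on S f"
| "times_differentiable_on (Suc n) f S \<longleftrightarrow>
     (\<forall>x\<in>S. f differentiable (at x)) \<and>
     (\<forall>v. times_differentiable_on n (\<lambda>x. frechet_derivative f (at x) v) S)"

text \<open>Only meaningful for open \<open>S\<close>, the derivatives being two-sided.\<close>

definition smooth_on ::
    "('a::real_normed_vector \<Rightarrow> 'b::real_normed_vector) \<Rightarrow> 'a set \<Rightarrow> bool" where
  "smooth_on f S \<longleftrightarrow> (\<forall>n. times_differentiable_on n f S)"

definition symmetric_matrix :: "real^'m^'m::finite \<Rightarrow> bool" where
  "symmetric_matrix M \<longleftrightarrow> transpose M = M"

definition sym_pos_def :: "real^'m^'m::finite \<Rightarrow> bool" where
  "sym_pos_def M \<longleftrightarrow> symmetric_matrix M \<and> (\<forall>v. v \<noteq> 0 \<longrightarrow> 0 < v \<bullet> (M *v v))"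

definition scaled_hessian :: "(real^'m::finite \<Rightarrow> real) \<Rightarrow> real^'m \<Rightarrow> real^'m^'m" where
  "scaled_hessian e u = (2 * e u / (u \<bullet> (hessian e u *v u))) *\<^sub>R hessian e u"

section \<open>Polynomials of bounded total degree\<close>

text \<open>
  A multi-index is a function \<open>a :: 'd \<Rightarrow> nat\<close>. Polynomials are functions on the whole
  space; on an element, which has nonempty interior, this loses no information.
\<close>

definition poly_space :: "nat \<Rightarrow> (real^'d::finite \<Rightarrow> real) set" where
  "poly_space q =
     {f. \<exists>c. \<forall>x. f x = (\<Sum>a | (\<Sum>i\<in>UNIV. a i) \<le> q. c a * (\<Prod>i\<in>UNIV. (x $ i) ^ a i))}"

text \<open>
  The finite index type \<open>'b\<close> plays the role of \<open>{1, ..., dim (poly_space p)}\<close>.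
\<close>

definition orthonormal_poly_basis ::
    "(real^'d::finite) set \<Rightarrow> nat \<Rightarrow> ('b::finite \<Rightarrow> real^'d \<Rightarrow> real) \<Rightarrow> bool" where
  "orthonormal_poly_basis \<Omega> p \<phi> \<longleftrightarrow>
     (\<forall>\<alpha>. \<phi> \<alpha> \<in> poly_space p) \<and>
     (\<forall>f\<in>poly_space p. \<exists>c. \<forall>x. f x = (\<Sum>\<alpha>\<in>UNIV. c \<alpha> * \<phi> \<alpha> x)) \<and>
     (\<forall>\<alpha> \<beta>. integral \<Omega> (\<lambda>x. \<phi> \<alpha> x * \<phi> \<beta> x) = (if \<alpha> = \<beta> then 1 else 0))"

section \<open>Polytopal elements\<close>

text \<open>
  Elements need not be convex, and a flat face may be any finite union of convex polytopes of
  codimension one in a common hyperplane. The vector \<open>\<nu> F\<close> is the constant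
  outward unit normal on the face \<open>F\<close>; the last conjunct says that it points out of \<open>\<Omega>\<close>
  and that \<open>\<Omega>\<close> lies on one side only.
\<close>

definition polytopal_face :: "(real^'d::finite) set \<Rightarrow> bool" where
  "polytopal_face F \<longleftrightarrow>
     F \<noteq> {} \<and>
     aff_dim F = int CARD('d) - 1 \<and>
     (\<exists>\<T>. finite \<T> \<and> F = \<Union>\<T> \<and> (\<forall>T\<in>\<T>. polytope T \<and> aff_dim T = int CARD('d) - 1))"

definition polytopal_element ::
    "(real^'d::finite) set \<Rightarrow> (real^'d) set set \<Rightarrow> ((real^'d) set \<Rightarrow> real^'d) \<Rightarrow> bool" where
  "polytopal_element \<Omega> \<F> \<nu> \<longleftrightarrow>
     compact \<Omega> \<and> \<Omega> \<noteq> {} \<and> closure (interior \<Omega>) = \<Omega> \<and>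
     finite \<F> \<and> frontier \<Omega> = \<Union>\<F> \<and>
     (\<forall>F\<in>\<F>. polytopal_face F) \<and>
     pairwise (\<lambda>F F'. rel_interior F \<inter> rel_interior F' = {}) \<F> \<and>
     (\<forall>F\<in>\<F>. norm (\<nu> F) = 1 \<and> (\<forall>x\<in>F. \<forall>y\<in>F. \<nu> F \<bullet> (x - y) = 0) \<and>
       (\<forall>x\<in>rel_interior F. \<exists>\<epsilon>>0. \<forall>t. 0 < t \<and> t < \<epsilon> \<longrightarrow>
          x + t *\<^sub>R \<nu> F \<notin> \<Omega> \<and> x - t *\<^sub>R \<nu> F \<in> interior \<Omega>))"

text \<open>
  Lebesgue measure on the affine hull of \<open>F\<close>, in the dimension of that hull: the image of the
  coordinate Lebesgue measure under an isometric parametrization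
  \<open>s \<mapsto> x\<^sub>0 + (\<Sum>b\<in>B. s b *\<^sub>R b)\<close>, with \<open>B\<close> an orthonormal basis of the
  direction space. It does not depend on the choices of \<open>B\<close> and \<open>x\<^sub>0\<close>.
\<close>

definition affine_lborel :: "'a::euclidean_space set \<Rightarrow> 'a measure" where
  "affine_lborel F =
     (let x\<^sub>0 = (SOME x. x \<in> F);
          B = (SOME B. pairwise orthogonal B \<and> (\<forall>b\<in>B. norm b = 1) \<and>
                 span B = span {x - y | x y. x \<in> F \<and> y \<in> F})
      in distr (Pi\<^sub>M B (\<lambda>_. lborel)) borel (\<lambda>s. x\<^sub>0 + (\<Sum>b\<in>B. s b *\<^sub>R b)))"

definition face_integral :: "(real^'d::finite) set \<Rightarrow> (real^'d \<Rightarrow> real) \<Rightarrow> real" where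
  "face_integral F f = set_lebesgue_integral (affine_lborel F) F f"

section \<open>Quadratures and discrete projection\<close>

text \<open>A quadrature consists of its nodes and its weights.\<close>

type_synonym 'd quadrature = "(real^'d) set \<times> (real^'d \<Rightarrow> real)"

definition quad :: "'d::finite quadrature \<Rightarrow> (real^'d \<Rightarrow> 'v::real_vector) \<Rightarrow> 'v" where
  "quad Q f = (\<Sum>x\<in>fst Q. snd Q x *\<^sub>R f x)"

definition positive_quadrature :: "(real^'d::finite) set \<Rightarrow> 'd quadrature \<Rightarrow> bool" where
  "positive_quadrature S Q \<longleftrightarrow> finite (fst Q) \<and> fst Q \<subseteq> S \<and> (\<forall>x\<in>fst Q. 0 < snd Q x)"

definition volume_quadrature :: "(real^'d::finite) set \<Rightarrow> nat \<Rightarrow> 'd quadrature \<Rightarrow> bool" where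
  "volume_quadrature \<Omega> q Q \<longleftrightarrow>
     positive_quadrature \<Omega> Q \<and> (\<forall>f\<in>poly_space q. quad Q f = integral \<Omega> f)"

definition face_quadrature :: "(real^'d::finite) set \<Rightarrow> nat \<Rightarrow> 'd quadrature \<Rightarrow> bool" where
  "face_quadrature F q Q \<longleftrightarrow>
     positive_quadrature F Q \<and> (\<forall>f\<in>poly_space q. quad Q f = face_integral F f)"

definition is_discrete_projection ::
    "'d::finite quadrature \<Rightarrow> nat \<Rightarrow> (real^'d \<Rightarrow> real) \<Rightarrow> (real^'d \<Rightarrow> real) \<Rightarrow> bool" where
  "is_discrete_projection Q q f g \<longleftrightarrow>
     g \<in> poly_space q \<and> (\<forall>\<psi>\<in>poly_space q. quad Q (\<lambda>x. \<psi> x * (f x - g x)) = 0)"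

definition projection_well_defined :: "'d::finite quadrature \<Rightarrow> nat \<Rightarrow> bool" where
  "projection_well_defined Q q \<longleftrightarrow> (\<forall>f. \<exists>!g. is_discrete_projection Q q f g)"

definition discrete_projection ::
    "'d::finite quadrature \<Rightarrow> nat \<Rightarrow> (real^'d \<Rightarrow> real) \<Rightarrow> real^'d \<Rightarrow> real" where
  "discrete_projection Q q f = (THE g. is_discrete_projection Q q f g)"

definition matrix_projection ::
    "'d::finite quadrature \<Rightarrow> nat \<Rightarrow> (real^'d \<Rightarrow> real^'m^'m::finite) \<Rightarrow> real^'d \<Rightarrow> real^'m^'m" where
  "matrix_projection Q q M x = (\<chi> i j. discrete_projection Q q (\<lambda>y. M y $ i $ j) x)"

section \<open>Coupled projection Galerkin operators\<close>

text \<open>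
  A block matrix has type \<open>real^'m^'m^'b^'b\<close>: the outer two indices select the block.
\<close>

definition block_transpose ::
    "real^'m^'m^'b^'b \<Rightarrow> real^'m^'m::finite^'b^'b::finite" where
  "block_transpose Z = (\<chi> \<alpha> \<beta>. transpose (Z $ \<beta> $ \<alpha>))"

definition basis_block ::
    "('b::finite \<Rightarrow> real^'d::finite \<Rightarrow> real) \<Rightarrow> 'b \<Rightarrow> real^'d \<Rightarrow> real^'m^'m::finite" where
  "basis_block \<phi> \<alpha> x = \<phi> \<alpha> x *\<^sub>R mat 1"

definition projected_coefficient ::
    "(real^'m::finite \<Rightarrow> real) \<Rightarrow> ('d::finite \<Rightarrow> real^'m \<Rightarrow> real^'m^'m) \<Rightarrow> 'd quadrature \<Rightarrow>
     nat \<Rightarrow> (real^'d \<Rightarrow> real^'m) \<Rightarrow> 'd \<Rightarrow> real^'d \<Rightarrow> real^'m^'m" where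
  "projected_coefficient e X Q q u k =
     matrix_projection Q q (\<lambda>x. scaled_hessian e (u x) ** X k (u x))"

definition cpg_N ::
    "'d::finite quadrature \<Rightarrow> ('b::finite \<Rightarrow> real^'d \<Rightarrow> real) \<Rightarrow>
     ('d \<Rightarrow> real^'d \<Rightarrow> real^'m^'m::finite) \<Rightarrow> real^'m^'m^'b^'b" where
  "cpg_N Q \<phi> Y = (\<chi> \<alpha> \<beta>. \<Sum>k\<in>UNIV.
     quad Q (\<lambda>x. transpose (basis_block \<phi> \<alpha> x) ** Y k x ** partial_deriv k (basis_block \<phi> \<beta>) x))"

definition cpg_V ::
    "'d::finite quadrature \<Rightarrow> ('b::finite \<Rightarrow> real^'d \<Rightarrow> real) \<Rightarrow>
     ('d \<Rightarrow> real^'d \<Rightarrow> real^'m^'m::finite) \<Rightarrow> real^'m^'m^'b^'b" where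
  "cpg_V Q \<phi> Y = (\<chi> \<alpha> \<beta>. \<Sum>k\<in>UNIV.
     quad Q (\<lambda>x. transpose (basis_block \<phi> \<alpha> x) ** partial_deriv k (Y k) x ** basis_block \<phi> \<beta> x))"

definition cpg_B ::
    "(real^'d::finite) set set \<Rightarrow> ((real^'d) set \<Rightarrow> real^'d) \<Rightarrow> ((real^'d) set \<Rightarrow> 'd quadrature) \<Rightarrow>
     ('b::finite \<Rightarrow> real^'d \<Rightarrow> real) \<Rightarrow>
     ('d \<Rightarrow> real^'d \<Rightarrow> real^'m^'m::finite) \<Rightarrow> real^'m^'m^'b^'b" where
  "cpg_B \<F> \<nu> Q \<phi> Y = (\<chi> \<alpha> \<beta>. \<Sum>k\<in>UNIV. \<Sum>F\<in>\<F>.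
     quad (Q F) (\<lambda>x. (\<nu> F $ k) *\<^sub>R
       (transpose (basis_block \<phi> \<alpha> x) ** Y k x ** basis_block \<phi> \<beta> x)))"

end

theory Submission
  imports Defs
begin

text \<open>
  The identity is integration by parts, carried out exactly by the quadratures. Write $y$ for one
  entry $Y_{k,ij}$ of the projected coefficient. Modulo one exchange of indices, the entry
  $(\alpha,\beta,i,j)$ of $N + N^T + V$ collects the three terms of the product rule for
  $\partial_k(\phi_\alpha\, y\, \phi_\beta)$, and the same entry of $B$ collects the face values of
  $\phi_\alpha\, y\, \phi_\beta\, n_k$.

  \<^item> The exchange of indices. The block transpose in $N^T$ yields the entry $Y_{k,ji}$, so the
    argument needs $Y_k$ to be symmetric. Differentiating the compatibility relation
    $\nabla e^\top A_k = \nabla g_k^\top$ gives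
    $\mathcal{H}_e A_k = \nabla^2 g_k - \sum_i (\partial_i e) \nabla^2 F_{k,i}$, which is symmetric
    because second derivatives commute. Hence $H A_k$ is symmetric, and so is
    $H \Delta A_k = G_k - H A_k$. A discrete projection depends only on the values at the
    quadrature nodes, where the state is admissible, and it acts entrywise; it therefore preserves
    symmetry (\<open>matrix_projection_symmetric\<close>).

  \<^item> Exactness. The function $\phi_\alpha\, y\, \phi_\beta$ has degree at most
    $p + (p+1) + p = 3p+1$ and its derivatives have degree at most $3p$. The two quadratures
    thus integrate both sides exactly (\<open>quadrature_integration_by_parts\<close>).

  \<^item> The divergence theorem $\int_\Omega \partial_v f = \sum_F (\nu_F \cdot v) \int_F f$ on a
    polytopal element, \<open>divergence_polytopal_element\<close>. It is proved line by line in the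
    direction $v$. Almost every line meets the boundary only in relative interiors of faces
    that it crosses transversally; at each crossing it enters or leaves $\Omega$ according to the
    sign of $\nu_F \cdot v$, and the fundamental theorem of calculus turns the integral over the line
    into the sum of $\pm f$ over the crossings. Integrating over all lines turns the crossings with
    $F$ into an integral over $F$, with Jacobian $|\nu_F \cdot v|$.

  To integrate over the lines without a measure on a quotient space, the lines are parametrized with
  redundancy by the points $x$ of the strip $0 \le v \cdot x < 1$, which has width one along every
  line. Both changes of variables then follow from Tonelli's theorem and the invariance of
  Lebesgue measure under translations and orthogonal maps; no determinant appears.
\<close>

section \<open>Polynomials of bounded total degree\<close>

lemma finite_bounded_multi_indices:
  "finite {a :: 'd::finite \<Rightarrow> nat. (\<Sum>i\<in>UNIV. a i) \<le> q}"
proof (rule finite_subset)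
  have "a i \<le> q" if "(\<Sum>i\<in>UNIV. a i) \<le> q" for a :: "'d \<Rightarrow> nat" and i
    using member_le_sum[of i UNIV a] that by simp
  then show "{a :: 'd \<Rightarrow> nat. (\<Sum>i\<in>UNIV. a i) \<le> q} \<subseteq> (\<Pi>\<^sub>E i\<in>UNIV. {..q})"
    by (auto simp: PiE_def)
  show "finite (\<Pi>\<^sub>E i\<in>(UNIV::'d set). {..q})"
    by (rule finite_PiE) auto
qed

definition monomial :: "('d::finite \<Rightarrow> nat) \<Rightarrow> real^'d \<Rightarrow> real" where
  "monomial a x = (\<Prod>i\<in>UNIV. (x $ i) ^ a i)"

lemma mem_poly_space_iff:
  "f \<in> poly_space q \<longleftrightarrow>
    (\<exists>c. f = (\<lambda>x. \<Sum>a | (\<Sum>i\<in>UNIV. a i) \<le> q. c a * monomial a x))"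
  by (auto simp: poly_space_def monomial_def fun_eq_iff)

lemma poly_space_zero: "(\<lambda>x. 0) \<in> poly_space q"
  unfolding mem_poly_space_iff by (rule exI[of _ "\<lambda>_. 0"]) simp

lemma poly_space_add:
  assumes "f \<in> poly_space q" "g \<in> poly_space q"
  shows "(\<lambda>x. f x + g x) \<in> poly_space q"
proof -
  obtain c c' where "f = (\<lambda>x. \<Sum>a | (\<Sum>i\<in>UNIV. a i) \<le> q. c a * monomial a x)"
    "g = (\<lambda>x. \<Sum>a | (\<Sum>i\<in>UNIV. a i) \<le> q. c' a * monomial a x)"
    using assms by (auto simp: mem_poly_space_iff)
  then show ?thesis
    unfolding mem_poly_space_iff
    by (intro exI[of _ "\<lambda>a. c a + c' a"]) (simp add: sum.distrib distrib_right)
qed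

lemma poly_space_cmult:
  assumes "f \<in> poly_space q" shows "(\<lambda>x. r * f x) \<in> poly_space q"
proof -
  obtain c where "f = (\<lambda>x. \<Sum>a | (\<Sum>i\<in>UNIV. a i) \<le> q. c a * monomial a x)"
    using assms by (auto simp: mem_poly_space_iff)
  then show ?thesis
    unfolding mem_poly_space_iff
    by (intro exI[of _ "\<lambda>a. r * c a"]) (simp add: sum_distrib_left mult.assoc)
qed

lemma poly_space_sum:
  assumes "\<And>j. j \<in> J \<Longrightarrow> f j \<in> poly_space q"
  shows "(\<lambda>x. \<Sum>j\<in>J. f j x) \<in> poly_space q"
proof (cases "finite J")
  case True
  then show ?thesis using assms
    by (induction J rule: finite_induct) (simp_all add: poly_space_zero poly_space_add)
qed (simp add: poly_space_zero)

lemma monomial_in_poly_space: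
  assumes "(\<Sum>i\<in>UNIV. a i) \<le> q"
  shows "monomial a \<in> poly_space q"
proof -
  have "monomial a x = (\<Sum>b | (\<Sum>i\<in>UNIV. b i) \<le> q. (if b = a then 1 else 0) * monomial b x)" for x
  proof -
    have "(\<Sum>b | (\<Sum>i\<in>UNIV. b i) \<le> q. (if b = a then 1 else 0) * monomial b x) =
        (\<Sum>b | (\<Sum>i\<in>UNIV. b i) \<le> q. if b = a then monomial b x else 0)"
      by (intro sum.cong) auto
    then show ?thesis
      using assms by (simp add: sum.delta[OF finite_bounded_multi_indices])
  qed
  then show ?thesis
    unfolding mem_poly_space_iff by (intro exI[of _ "\<lambda>b. if b = a then 1 else 0"]) blast
qed

lemma poly_space_expansion:
  assumes "f \<in> poly_space q"
  shows "\<exists>c. \<forall>x. f x = (\<Sum>a | (\<Sum>i\<in>UNIV. a i) \<le> q. c a * monomial a x)"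
  using assms by (auto simp: mem_poly_space_iff)

lemma monomial_mult: "monomial a x * monomial b x = monomial (\<lambda>i. a i + b i) x"
  by (simp add: monomial_def power_add prod.distrib)

lemma poly_space_mult:
  assumes "f \<in> poly_space q" "g \<in> poly_space r"
  shows "(\<lambda>x. f x * g x) \<in> poly_space (q + r)"
proof -
  obtain c where c: "\<And>x. f x = (\<Sum>a | (\<Sum>i\<in>UNIV. a i) \<le> q. c a * monomial a x)"
    using poly_space_expansion[OF assms(1)] by blast
  obtain d where d: "\<And>x. g x = (\<Sum>a | (\<Sum>i\<in>UNIV. a i) \<le> r. d a * monomial a x)"
    using poly_space_expansion[OF assms(2)] by blast
  have "f x * g x = (\<Sum>a | (\<Sum>i\<in>UNIV. a i) \<le> q. \<Sum>b | (\<Sum>i\<in>UNIV. b i) \<le> r.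
      c a * d b * monomial (\<lambda>i. a i + b i) x)" for x
    unfolding c d sum_product by (simp add: monomial_mult[symmetric] ac_simps)
  then show ?thesis
    by (simp, intro poly_space_sum poly_space_cmult monomial_in_poly_space)
       (simp add: sum.distrib add_mono)
qed

text \<open>
  The truncated exponent $a_k - 1$ is harmless for $a_k = 0$, where the factor $a_k$ vanishes.
\<close>

lemma has_derivative_monomial:
  "(monomial a has_derivative
     (\<lambda>v. \<Sum>k\<in>UNIV. v $ k * (real (a k) * monomial (a(k := a k - 1)) x))) (at x)"
proof -
  have "(monomial a has_derivative
     (\<lambda>v. \<Sum>k\<in>UNIV. (of_nat (a k) * v $ k * (x $ k) ^ (a k - 1)) *
        (\<Prod>j\<in>UNIV - {k}. (x $ j) ^ a j))) (at x)"
    unfolding monomial_def[abs_def]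
    by (intro has_derivative_prod has_derivative_power bounded_linear.has_derivative[OF bounded_linear_vec_nth]
        has_derivative_ident)
  moreover have "of_nat (a k) * v * (x $ k) ^ (a k - 1) * (\<Prod>j\<in>UNIV - {k}. (x $ j) ^ a j) =
      v * (real (a k) * monomial (a(k := a k - 1)) x)" for k v
    unfolding monomial_def by (subst (2) prod.remove[of _ k]) (auto simp: ac_simps intro!: prod.cong)
  ultimately show ?thesis by (simp only:)
qed

lemma partial_deriv_unique:
  assumes "(f has_derivative f') (at x)"
  shows "partial_deriv k f x = f' (axis k 1)"
  using frechet_derivative_at[OF assms] by (simp add: partial_deriv_def)

lemma poly_space_differentiable:
  assumes "f \<in> poly_space q" shows "f differentiable (at x)"
proof -
  obtain c where c: "\<And>x. f x = (\<Sum>a | (\<Sum>i\<in>UNIV. a i) \<le> q. c a * monomial a x)"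
    using poly_space_expansion[OF assms] by blast
  have "(\<lambda>x. \<Sum>a | (\<Sum>i\<in>UNIV. a i) \<le> q. c a * monomial a x) differentiable (at x)"
    using has_derivative_monomial[of _ x]
    by (intro differentiable_sum ballI differentiable_mult finite_bounded_multi_indices) (auto simp: differentiable_def)
  then show ?thesis by (simp add: c[abs_def])
qed

lemma partial_deriv_poly_space:
  assumes "f \<in> poly_space (Suc q)"
  shows "partial_deriv k f \<in> poly_space q"
proof -
  obtain c where c: "\<And>x. f x = (\<Sum>a | (\<Sum>i\<in>UNIV. a i) \<le> Suc q. c a * monomial a x)"
    using poly_space_expansion[OF assms] by blast
  have "((\<lambda>x. \<Sum>a | (\<Sum>i\<in>UNIV. a i) \<le> Suc q. c a * monomial a x) has_derivative
      (\<lambda>v. \<Sum>a | (\<Sum>i\<in>UNIV. a i) \<le> Suc q. c a *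
        (\<Sum>k\<in>UNIV. v $ k * (real (a k) * monomial (a(k := a k - 1)) x)))) (at x)" for x
    by (intro has_derivative_sum has_derivative_mult_right has_derivative_monomial)
  then have "partial_deriv k f x = (\<Sum>a | (\<Sum>i\<in>UNIV. a i) \<le> Suc q. c a *
        (\<Sum>l\<in>UNIV. axis k 1 $ l * (real (a l) * monomial (a(l := a l - 1)) x)))" for x
    unfolding c[abs_def] by (rule partial_deriv_unique)
  then have "partial_deriv k f = (\<lambda>x. \<Sum>a | (\<Sum>i\<in>UNIV. a i) \<le> Suc q.
      c a * (real (a k) * monomial (a(k := a k - 1)) x))"
    by (simp add: fun_eq_iff axis_def if_distrib[of "\<lambda>t. t * _"] cong: if_cong)
  moreover have "(\<lambda>x. real (a k) * monomial (a(k := a k - 1)) x) \<in> poly_space q"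
    if "(\<Sum>i\<in>UNIV. a i) \<le> Suc q" for a
  proof (cases "a k = 0")
    case False
    have "(\<Sum>i\<in>UNIV. (a(k := a k - 1)) i) = (\<Sum>i\<in>UNIV. a i) - 1"
      using False by (subst (1 2) sum.remove[of _ k]) (auto intro!: arg_cong2[where f="(+)"] sum.cong)
    then show ?thesis
      using that by (intro poly_space_cmult monomial_in_poly_space) simp
  qed (simp add: poly_space_zero)
  ultimately show ?thesis
    by (simp only:) (rule poly_space_sum, rule poly_space_cmult, simp only: mem_Collect_eq)
qed

lemma continuous_on_poly_space: "f \<in> poly_space q \<Longrightarrow> continuous_on S f"
  by (meson continuous_at_imp_continuous_on differentiable_imp_continuous_within poly_space_differentiable)

section \<open>Symmetry of the scaled coefficient matrices\<close>

text \<open>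
  Differentiability along lines is always expressed at parameter value zero, for every base point;
  moving the base point along the line gives the derivative at every other parameter value.
\<close>

lemma directional_derivative_along_line:
  fixes f :: "'a::real_normed_vector \<Rightarrow> real"
  assumes "((\<lambda>t. f (x + s *\<^sub>R a + t *\<^sub>R a)) has_real_derivative d) (at 0)"
  shows "((\<lambda>t. f (x + t *\<^sub>R a)) has_real_derivative d) (at s)"
proof -
  have "((\<lambda>t. f (x + (t + s) *\<^sub>R a)) has_real_derivative d) (at 0)"
    using assms by (simp add: scaleR_add_left add.assoc add.commute add.left_commute)
  then show ?thesis
    using DERIV_shift[where f="\<lambda>t. f (x + t *\<^sub>R a)" and x=0 and z=s and y=d] by simp
qed

text \<open>
  Two applications of the mean value theorem, first to the increment of $f$ along $b$ as a function of
  the parameter along $a$, then along $b$.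
\<close>

lemma second_difference_mean_value:
  fixes f :: "'a::real_normed_vector \<Rightarrow> real"
  assumes h: "0 < h" and D: "\<And>s t. 0 \<le> s \<Longrightarrow> s \<le> h \<Longrightarrow> 0 \<le> t \<Longrightarrow> t \<le> h \<Longrightarrow> u + s *\<^sub>R a + t *\<^sub>R b \<in> D"
    and fa: "\<And>x. x \<in> D \<Longrightarrow> ((\<lambda>t. f (x + t *\<^sub>R a)) has_real_derivative fa x) (at 0)"
    and fab: "\<And>x. x \<in> D \<Longrightarrow> ((\<lambda>t. fa (x + t *\<^sub>R b)) has_real_derivative fab x) (at 0)"
  obtains s t where "0 < s" "s < h" "0 < t" "t < h"
    "f (u + h *\<^sub>R a + h *\<^sub>R b) - f (u + h *\<^sub>R a) - f (u + h *\<^sub>R b) + f u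
      = h * h * fab (u + s *\<^sub>R a + t *\<^sub>R b)"
proof -
  have swap: "u + s *\<^sub>R a + t *\<^sub>R b = u + t *\<^sub>R b + s *\<^sub>R a" for s t
    by (simp only: add.assoc add.commute[of "s *\<^sub>R a"])
  have *: "((\<lambda>s. f (u + t *\<^sub>R b + s *\<^sub>R a)) has_real_derivative fa (u + s *\<^sub>R a + t *\<^sub>R b)) (at s)"
    if "0 \<le> s" "s \<le> h" "0 \<le> t" "t \<le> h" for s t
    using fa[OF D[OF that]] unfolding swap[of s t] by (rule directional_derivative_along_line)
  have "((\<lambda>s. f (u + h *\<^sub>R b + s *\<^sub>R a) - f (u + s *\<^sub>R a)) has_real_derivative
      fa (u + s *\<^sub>R a + h *\<^sub>R b) - fa (u + s *\<^sub>R a)) (at s)" if "0 \<le> s" "s \<le> h" for s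
    using *[OF that, of h] *[OF that, of 0] h by (intro DERIV_diff) auto
  from MVT2[OF h this] obtain s where s: "0 < s" "s < h" and
    1: "f (u + h *\<^sub>R b + h *\<^sub>R a) - f (u + h *\<^sub>R a) - (f (u + h *\<^sub>R b) - f u)
      = h * (fa (u + s *\<^sub>R a + h *\<^sub>R b) - fa (u + s *\<^sub>R a))"
    by auto
  have "((\<lambda>t. fa (u + s *\<^sub>R a + t *\<^sub>R b)) has_real_derivative fab (u + s *\<^sub>R a + t *\<^sub>R b)) (at t)"
    if "0 \<le> t" "t \<le> h" for t
    by (rule directional_derivative_along_line, rule fab, rule D) (use that s in auto)
  from MVT2[OF h this] obtain t where t: "0 < t" "t < h" and
    2: "fa (u + s *\<^sub>R a + h *\<^sub>R b) - fa (u + s *\<^sub>R a) = h * fab (u + s *\<^sub>R a + t *\<^sub>R b)"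
    by auto
  show ?thesis
    using 1 unfolding 2 swap[of h h] by (intro that[OF s t]) (simp add: swap[of h h])
qed

text \<open>
  The second difference over a small parallelogram is symmetric in the two directions. By the mean value
  form it equals $h^2$ times either mixed derivative at a point close to $u$, so continuity forces the
  two values at $u$ to agree.
\<close>

lemma mixed_directional_derivatives_commute:
  fixes f :: "'a::real_normed_vector \<Rightarrow> real"
  assumes D: "open D" "u \<in> D"
    and fa: "\<And>x. x \<in> D \<Longrightarrow> ((\<lambda>t. f (x + t *\<^sub>R a)) has_real_derivative fa x) (at 0)"
    and fb: "\<And>x. x \<in> D \<Longrightarrow> ((\<lambda>t. f (x + t *\<^sub>R b)) has_real_derivative fb x) (at 0)"
    and fab: "\<And>x. x \<in> D \<Longrightarrow> ((\<lambda>t. fa (x + t *\<^sub>R b)) has_real_derivative fab x) (at 0)"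
    and fba: "\<And>x. x \<in> D \<Longrightarrow> ((\<lambda>t. fb (x + t *\<^sub>R a)) has_real_derivative fba x) (at 0)"
    and cont: "continuous_on D fab" "continuous_on D fba"
  shows "fab u = fba u"
proof (rule ccontr)
  assume neq: "fab u \<noteq> fba u"
  define \<epsilon> where "\<epsilon> = \<bar>fab u - fba u\<bar> / 2"
  have \<epsilon>: "\<epsilon> > 0" using neq by (simp add: \<epsilon>_def)
  have "\<forall>\<^sub>F x in nhds u. x \<in> D \<and> dist (fab x) (fab u) < \<epsilon> \<and> dist (fba x) (fba u) < \<epsilon>"
    using D cont \<epsilon> by (intro eventually_conj eventually_nhds_in_open tendstoD)
      (auto simp: continuous_on_eq_continuous_at isCont_def tendsto_at_iff_tendsto_nhds)
  then obtain \<delta> where \<delta>: "\<delta> > 0" and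
    near: "\<And>x. dist x u < \<delta> \<Longrightarrow> x \<in> D \<and> dist (fab x) (fab u) < \<epsilon> \<and> dist (fba x) (fba u) < \<epsilon>"
    by (auto simp: eventually_nhds_metric)
  \<comment> \<open>the parallelogram with side factor \<open>\<delta> / (2 * N)\<close> stays in the ball of radius \<open>\<delta>\<close>\<close>
  define N where "N = norm a + norm b + 1"
  have pos: "N > 0" unfolding N_def by (intro add_nonneg_pos add_nonneg_nonneg) auto
  define h where "h = \<delta> / (2 * N)"
  have h: "h > 0" using \<delta> pos by (simp add: h_def)
  have dist: "dist (u + s *\<^sub>R a + t *\<^sub>R b) u < \<delta>" if "0 \<le> s" "s \<le> h" "0 \<le> t" "t \<le> h" for s t
  proof -
    have "dist (u + s *\<^sub>R a + t *\<^sub>R b) u = norm (s *\<^sub>R a + t *\<^sub>R b)"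
      by (simp add: dist_norm add.assoc)
    also have "\<dots> \<le> s * norm a + t * norm b"
      using that by (intro norm_triangle_le) simp
    also have "\<dots> \<le> h * norm a + h * norm b"
      using that by (intro add_mono mult_right_mono) auto
    also have "\<dots> \<le> h * N" using h by (simp add: N_def algebra_simps)
    also have "\<dots> = \<delta> / 2" using pos by (simp add: h_def)
    also have "\<dots> < \<delta>" using \<delta> by simp
    finally show ?thesis .
  qed
  obtain s t where st: "0 < s" "s < h" "0 < t" "t < h" and
    1: "f (u + h *\<^sub>R a + h *\<^sub>R b) - f (u + h *\<^sub>R a) - f (u + h *\<^sub>R b) + f u
      = h * h * fab (u + s *\<^sub>R a + t *\<^sub>R b)"
  proof (rule second_difference_mean_value[OF h _ fa fab])
    fix s t assume "0 \<le> s" "s \<le> h" "0 \<le> t" "t \<le> h"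
    then show "u + s *\<^sub>R a + t *\<^sub>R b \<in> D"
      using near[OF dist[of s t]] by blast
  qed
  have dist': "dist (u + t *\<^sub>R b + s *\<^sub>R a) u < \<delta>" if "0 \<le> s" "s \<le> h" "0 \<le> t" "t \<le> h" for s t
    using dist[OF that] by (simp only: ac_simps)
  obtain s' t' where st': "0 < t'" "t' < h" "0 < s'" "s' < h" and
    2: "f (u + h *\<^sub>R b + h *\<^sub>R a) - f (u + h *\<^sub>R b) - f (u + h *\<^sub>R a) + f u
      = h * h * fba (u + t' *\<^sub>R b + s' *\<^sub>R a)"
  proof (rule second_difference_mean_value[OF h _ fb fba])
    fix s t assume "0 \<le> s" "s \<le> h" "0 \<le> t" "t \<le> h"
    then show "u + s *\<^sub>R b + t *\<^sub>R a \<in> D"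
      using near[OF dist'[of t s]] by blast
  qed
  have swap: "f (u + h *\<^sub>R b + h *\<^sub>R a) = f (u + h *\<^sub>R a + h *\<^sub>R b)"
    by (simp only: ac_simps)
  have "h * h * fab (u + s *\<^sub>R a + t *\<^sub>R b) = h * h * fba (u + t' *\<^sub>R b + s' *\<^sub>R a)"
    using 1 2 unfolding swap by linarith
  then have "fab (u + s *\<^sub>R a + t *\<^sub>R b) = fba (u + t' *\<^sub>R b + s' *\<^sub>R a)"
    using h by simp
  moreover have "dist (fab (u + s *\<^sub>R a + t *\<^sub>R b)) (fab u) < \<epsilon>"
    using near[OF dist[of s t]] st by simp
  moreover have "dist (fba (u + t' *\<^sub>R b + s' *\<^sub>R a)) (fba u) < \<epsilon>"
    using near[OF dist'[of s' t']] st' by simp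
  moreover have "\<bar>fab u - fba u\<bar> = 2 * \<epsilon>" by (simp add: \<epsilon>_def)
  ultimately show False unfolding dist_real_def by linarith
qed

lemma smooth_on_derivatives:
  assumes "smooth_on f D" "x \<in> D"
  shows "(f has_derivative frechet_derivative f (at x)) (at x)"
    and "((\<lambda>y. frechet_derivative f (at y) a) has_derivative
           frechet_derivative (\<lambda>y. frechet_derivative f (at y) a) (at x)) (at x)"
    and "continuous_on D (\<lambda>y. frechet_derivative (\<lambda>z. frechet_derivative f (at z) a) (at y) b)"
proof -
  have *: "times_differentiable_on (Suc (Suc 0)) f D"
    using assms(1) unfolding smooth_on_def by blast
  show "(f has_derivative frechet_derivative f (at x)) (at x)"
    using * assms(2) by (simp flip: frechet_derivative_works)
  show "((\<lambda>y. frechet_derivative f (at y) a) has_derivative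
           frechet_derivative (\<lambda>y. frechet_derivative f (at y) a) (at x)) (at x)"
    using * assms(2) by (simp flip: frechet_derivative_works)
  show "continuous_on D (\<lambda>y. frechet_derivative (\<lambda>z. frechet_derivative f (at z) a) (at y) b)"
    using * by simp
qed

lemma has_derivative_imp_directional:
  fixes f :: "'a::real_normed_vector \<Rightarrow> real"
  assumes "(f has_derivative f') (at x)"
  shows "((\<lambda>t. f (x + t *\<^sub>R a)) has_real_derivative f' a) (at 0)"
proof -
  have "((\<lambda>t. f (x + t *\<^sub>R a)) has_derivative (\<lambda>t. f' (t *\<^sub>R a))) (at 0)"
    by (rule has_derivative_compose[of "\<lambda>t. x + t *\<^sub>R a" "\<lambda>t. t *\<^sub>R a" 0 UNIV f f'])
       (use assms in \<open>auto intro!: derivative_eq_intros\<close>)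
  moreover have "f' (t *\<^sub>R a) = t * f' a" for t
    by (simp add: linear_scale[OF has_derivative_linear[OF assms]])
  ultimately show ?thesis
    by (simp add: has_field_derivative_def mult_commute_abs)
qed

lemma smooth_on_second_derivative_commute:
  fixes f :: "'a::real_normed_vector \<Rightarrow> 'b::euclidean_space"
  assumes D: "open D" "u \<in> D" and f: "smooth_on f D"
  shows "frechet_derivative (\<lambda>x. frechet_derivative f (at x) a) (at u) b
       = frechet_derivative (\<lambda>x. frechet_derivative f (at x) b) (at u) a"
proof (rule euclidean_eqI)
  fix c :: 'b
  have first: "((\<lambda>t. f (x + t *\<^sub>R v) \<bullet> c) has_real_derivative frechet_derivative f (at x) v \<bullet> c) (at 0)"
    if "x \<in> D" for x v
    by (rule has_derivative_imp_directional[OF has_derivative_inner_left])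
       (rule smooth_on_derivatives(1)[OF f that])
  have second: "((\<lambda>t. frechet_derivative f (at (x + t *\<^sub>R w)) v \<bullet> c) has_real_derivative
      frechet_derivative (\<lambda>y. frechet_derivative f (at y) v) (at x) w \<bullet> c) (at 0)"
    if "x \<in> D" for x v w
    by (rule has_derivative_imp_directional[OF has_derivative_inner_left])
       (rule smooth_on_derivatives(2)[OF f that])
  have cont: "continuous_on D (\<lambda>x. frechet_derivative (\<lambda>y. frechet_derivative f (at y) v) (at x) w \<bullet> c)"
    for v w
    by (intro continuous_intros smooth_on_derivatives(3)[OF f D(2)])
  show "frechet_derivative (\<lambda>x. frechet_derivative f (at x) a) (at u) b \<bullet> c
       = frechet_derivative (\<lambda>x. frechet_derivative f (at x) b) (at u) a \<bullet> c"
    by (rule mixed_directional_derivatives_commute[OF D first first second second cont cont])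
qed

lemma has_derivative_vec_lambda:
  fixes f :: "'m::finite \<Rightarrow> 'a::real_normed_vector \<Rightarrow> real"
  assumes "\<And>i. (f i has_derivative f' i) (at x)"
  shows "((\<lambda>x. \<chi> i. f i x) has_derivative (\<lambda>h. \<chi> i. f' i h)) (at x)"
  by (subst has_derivative_componentwise_within) (use assms in \<open>auto simp: Basis_vec_def inner_axis\<close>)

lemma hessian_nth:
  assumes "smooth_on e D" "u \<in> D"
  shows "hessian e u $ i $ l = partial_deriv l (partial_deriv i e) u"
proof -
  have "(grad e has_derivative (\<lambda>h. \<chi> i. frechet_derivative (partial_deriv i e) (at u) h)) (at u)"
    unfolding grad_def[abs_def]
    by (rule has_derivative_vec_lambda) (use smooth_on_derivatives(2)[OF assms] in \<open>simp add: partial_deriv_def[abs_def]\<close>)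
  from frechet_derivative_at[OF this, symmetric] show ?thesis
    by (simp add: hessian_def jacobian_def matrix_def partial_deriv_def[of l])
qed

text \<open>
  Differentiating $\sum_i \partial_i e\, \partial_j F_i = \partial_j g$ in direction $l$ gives
  \[ (\mathcal{H}_e A)_{lj} = \partial_l \partial_j g - \sum_i \partial_i e\, \partial_l \partial_j F_i , \]
  and the right-hand side is symmetric in $l$ and $j$.
\<close>

lemma hessian_times_flux_jacobian_symmetric:
  fixes F :: "real^'m::finite \<Rightarrow> real^'m"
  assumes D: "open D" "u \<in> D"
    and smooth: "smooth_on F D" "smooth_on e D" "smooth_on g D"
    and pair: "\<And>u. u \<in> D \<Longrightarrow> grad e u v* jacobian F (at u) = grad g u"
    and sym: "symmetric_matrix (hessian e u)"
  shows "symmetric_matrix (hessian e u ** jacobian F (at u))"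
proof -
  let ?F = "\<lambda>j x. frechet_derivative F (at x) (axis j 1)"
  have A: "jacobian F (at x) $ i $ j = ?F j x $ i" for x i j
    by (simp add: jacobian_def matrix_def)
  have H: "hessian e u $ i $ l = frechet_derivative (partial_deriv i e) (at u) (axis l 1)" for i l
    using hessian_nth[OF smooth(2) D(2)] by (simp add: partial_deriv_def)
  have H_sym: "hessian e u $ l $ i = hessian e u $ i $ l" for i l
    using arg_cong[OF sym[unfolded symmetric_matrix_def], of "\<lambda>M. M $ i $ l"]
    by (simp add: transpose_def)
  have HS: "hessian e u $ l $ i = frechet_derivative (partial_deriv i e) (at u) (axis l 1)" for i l
    by (rule trans[OF H_sym H])
  have entry: "(hessian e u ** jacobian F (at u)) $ l $ j =
      frechet_derivative (partial_deriv j g) (at u) (axis l 1)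
      - (\<Sum>i\<in>UNIV. frechet_derivative (?F j) (at u) (axis l 1) $ i * partial_deriv i e u)" for l j
  proof -
    have "(\<Sum>i\<in>UNIV. ?F j x $ i * partial_deriv i e x) = partial_deriv j g x" if "x \<in> D" for x
      using arg_cong[OF pair[OF that], of "\<lambda>w. w $ j"] by (simp add: vector_matrix_mult_def grad_def A mult.commute)
    moreover have "(partial_deriv j g has_derivative frechet_derivative (partial_deriv j g) (at u)) (at u)"
      using smooth_on_derivatives(2)[OF smooth(3) D(2)] by (simp add: partial_deriv_def[abs_def])
    ultimately have "((\<lambda>x. \<Sum>i\<in>UNIV. ?F j x $ i * partial_deriv i e x) has_derivative
        frechet_derivative (partial_deriv j g) (at u)) (at u)"
      using D by (elim has_derivative_transform_within_open) auto
    moreover have "((\<lambda>x. \<Sum>i\<in>UNIV. ?F j x $ i * partial_deriv i e x) has_derivative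
        (\<lambda>h. \<Sum>i\<in>UNIV. ?F j u $ i * frechet_derivative (partial_deriv i e) (at u) h
          + frechet_derivative (?F j) (at u) h $ i * partial_deriv i e u)) (at u)"
      using smooth_on_derivatives(2)[OF smooth(1) D(2), of "axis j 1"]
        smooth_on_derivatives(2)[OF smooth(2) D(2)]
      by (intro has_derivative_sum has_derivative_mult
            bounded_linear.has_derivative[OF bounded_linear_vec_nth]) (auto simp: partial_deriv_def[abs_def])
    ultimately have "frechet_derivative (partial_deriv j g) (at u) =
        (\<lambda>h. \<Sum>i\<in>UNIV. ?F j u $ i * frechet_derivative (partial_deriv i e) (at u) h
          + frechet_derivative (?F j) (at u) h $ i * partial_deriv i e u)"
      by (rule has_derivative_unique)
    then show ?thesis
      by (simp add: matrix_matrix_mult_def A HS sum.distrib mult.commute[of "?F _ _ $ _"])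
  qed
  have "(hessian e u ** jacobian F (at u)) $ l $ j = (hessian e u ** jacobian F (at u)) $ j $ l" for l j
    unfolding entry partial_deriv_def[abs_def]
    by (subst smooth_on_second_derivative_commute[OF D smooth(3), of "axis l 1" "axis j 1"])
       (simp only: smooth_on_second_derivative_commute[OF D smooth(1), of "axis l 1" "axis j 1"])
  then show ?thesis
    by (simp add: symmetric_matrix_def transpose_def vec_eq_iff)
qed

lemma symmetric_matrix_scaleR: "symmetric_matrix M \<Longrightarrow> symmetric_matrix (r *\<^sub>R M)"
  by (simp add: symmetric_matrix_def transpose_def vec_eq_iff)

lemma scaled_hessian_times_flux_jacobian_symmetric:
  fixes F :: "real^'m::finite \<Rightarrow> real^'m"
  assumes "open D" "u \<in> D"
    and "smooth_on F D" "smooth_on e D" "smooth_on g D"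
    and "\<And>u. u \<in> D \<Longrightarrow> grad e u v* jacobian F (at u) = grad g u"
    and "symmetric_matrix (hessian e u)"
  shows "symmetric_matrix (scaled_hessian e u ** jacobian F (at u))"
  using symmetric_matrix_scaleR[OF hessian_times_flux_jacobian_symmetric[OF assms]]
  by (simp add: scaled_hessian_def scalar_matrix_assoc)

section \<open>Integrating a derivative over a union of intervals\<close>

text \<open>
  Here \<open>\<tau>\<close> enumerates the boundary points of \<open>E\<close>; the sign \<open>\<sigma> i\<close> is \<open>1\<close>
  where \<open>E\<close> lies to the left of \<open>\<tau> i\<close>, and \<open>-1\<close> where it lies to the right. Thus
  \<open>E\<close> is a finite union of intervals, and the claim is the fundamental theorem of calculus on each of
  them. Instead of listing the intervals, the proof repairs the jumps of \<open>indicator E * \<phi>\<close> by a step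
  function; the result is a continuous antiderivative on the whole line.
\<close>

lemma integral_derivative_over_alternating_set:
  fixes \<phi> \<phi>' :: "real \<Rightarrow> real" and E :: "real set" and \<tau> \<sigma> :: "'i \<Rightarrow> real"
  assumes I: "finite I" "inj_on \<tau> I" and E: "compact E"
    and deriv: "\<And>t. (\<phi> has_real_derivative \<phi>' t) (at t)" and cont: "continuous_on UNIV \<phi>'"
    and off: "\<And>t. t \<notin> \<tau> ` I \<Longrightarrow> \<forall>\<^sub>F s in nhds t. s \<in> E \<longleftrightarrow> t \<in> E"
    and sign: "\<And>i. i \<in> I \<Longrightarrow> \<sigma> i = 1 \<or> \<sigma> i = -1" and mem: "\<And>i. i \<in> I \<Longrightarrow> \<tau> i \<in> E"
    and cross: "\<And>i. i \<in> I \<Longrightarrow> \<exists>\<epsilon>>0. \<forall>t. 0 < t \<and> t < \<epsilon> \<longrightarrow> \<tau> i - \<sigma> i * t \<in> E \<and> \<tau> i + \<sigma> i * t \<notin> E"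
  shows "(LINT t|lborel. indicator E t * \<phi>' t) = (\<Sum>i\<in>I. \<sigma> i * \<phi> (\<tau> i))"
proof -
  \<comment> \<open>the strictness of the comparison is chosen such that \<open>W\<close> has the right value also at the jump itself\<close>
  define c where "c i s = (if \<sigma> i = 1 then of_bool (\<tau> i < s) else of_bool (\<tau> i \<le> s) :: real)" for i s
  define W where "W s = indicator E s * \<phi> s + (\<Sum>i\<in>I. \<sigma> i * \<phi> (\<tau> i) * c i s)" for s
  have c_const: "\<forall>\<^sub>F s in nhds t. c i s = c i t" if "t \<noteq> \<tau> i" for i t
  proof (cases "t < \<tau> i")
    case True
    then have "\<forall>\<^sub>F s in nhds t. s \<in> {..<\<tau> i}" by (intro eventually_nhds_in_open) auto
    then show ?thesis by eventually_elim (use True in \<open>auto simp: c_def\<close>)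
  next
    case False
    then have "\<forall>\<^sub>F s in nhds t. s \<in> {\<tau> i<..}" using that by (intro eventually_nhds_in_open) auto
    then show ?thesis by eventually_elim (use False that in \<open>auto simp: c_def\<close>)
  qed
  have W_deriv: "(W has_real_derivative indicator E t * \<phi>' t) (at t)" if t: "t \<notin> \<tau> ` I" for t
  proof -
    have "\<forall>\<^sub>F s in nhds t. \<forall>i\<in>I. c i s = c i t"
      using t I by (intro eventually_ball_finite ballI c_const) auto
    with off[OF t] have ev: "\<forall>\<^sub>F s in nhds t. W s = indicator E t * \<phi> s + (\<Sum>i\<in>I. \<sigma> i * \<phi> (\<tau> i) * c i t)"
      by eventually_elim (auto simp: W_def indicator_def)
    have "((\<lambda>s. indicator E t * \<phi> s + (\<Sum>i\<in>I. \<sigma> i * \<phi> (\<tau> i) * c i t)) has_real_derivative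
        indicator E t * \<phi>' t) (at t)"
      by (auto intro!: derivative_eq_intros deriv)
    then show ?thesis by (rule DERIV_cong_ev[OF refl ev refl, THEN iffD2])
  qed
  have W_cont: "isCont W t" for t
  proof (cases "t \<in> \<tau> ` I")
    case False
    then show ?thesis using W_deriv DERIV_isCont by blast
  next
    case True
    then obtain i where i: "i \<in> I" and t: "t = \<tau> i" by blast
    define K where "K = (\<Sum>j\<in>I - {i}. \<sigma> j * \<phi> (\<tau> j) * c j t)"
    \<comment> \<open>near \<open>\<tau> i\<close>, the repaired function is \<open>\<phi>\<close> stopped, or started, at \<open>\<tau> i\<close>\<close>
    define V where "V s = K + (if \<sigma> i = 1 then \<phi> (min s t) else \<phi> (max s t) - \<phi> t)" for s
    obtain \<epsilon> where \<epsilon>: "\<epsilon> > 0" and \<epsilon>': "\<And>t. 0 < t \<Longrightarrow> t < \<epsilon> \<Longrightarrow> \<tau> i - \<sigma> i * t \<in> E \<and> \<tau> i + \<sigma> i * t \<notin> E"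
      using cross[OF i] by blast
    have "\<forall>\<^sub>F s in nhds t. \<forall>j\<in>I - {i}. c j s = c j t"
      using t I i by (intro eventually_ball_finite ballI c_const) (auto simp: inj_on_def)
    moreover have "\<forall>\<^sub>F s in nhds t. s \<in> {t - \<epsilon><..<t + \<epsilon>}"
      using \<epsilon> by (intro eventually_nhds_in_open) auto
    ultimately have ev: "\<forall>\<^sub>F s in nhds t. W s = V s"
    proof eventually_elim
      case (elim s)
      have "W s = indicator E s * \<phi> s + \<sigma> i * \<phi> t * c i s + (\<Sum>j\<in>I - {i}. \<sigma> j * \<phi> (\<tau> j) * c j s)"
        using I i by (simp add: W_def sum.remove[of I i] t)
      also have "(\<Sum>j\<in>I - {i}. \<sigma> j * \<phi> (\<tau> j) * c j s) = K"
        using elim by (simp add: K_def)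
      finally have W: "W s = indicator E s * \<phi> s + \<sigma> i * \<phi> t * c i s + K" .
      have s: "s \<in> E \<longleftrightarrow> s = t \<or> (s - t) * \<sigma> i < 0"
        using \<epsilon>'[of "t - s"] \<epsilon>'[of "s - t"] sign[OF i] mem[OF i] elim
        by (cases "s < t"; cases "t < s") (auto simp: t)
      show ?case
        using sign[OF i] mem[OF i] unfolding W V_def
        by (cases "s < t"; cases "t < s") (auto simp: c_def t[symmetric] s indicator_def)
    qed
    have cont_\<phi>: "isCont \<phi> s" for s using deriv DERIV_isCont by blast
    have "isCont V t"
    proof (cases "\<sigma> i = 1")
      case True
      then show ?thesis unfolding V_def
        by (auto intro!: continuous_intros isCont_o2[of t "\<lambda>s. min s t" \<phi>] cont_\<phi>)
    next
      case False
      then show ?thesis unfolding V_def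
        by (auto intro!: continuous_intros isCont_o2[of t "\<lambda>s. max s t" \<phi>] cont_\<phi>)
    qed
    then show ?thesis using ev isCont_cong by blast
  qed
  have "bounded (E \<union> \<tau> ` I)" using E I by (simp add: compact_imp_bounded finite_imp_bounded)
  then obtain M where M: "\<And>x. x \<in> E \<union> \<tau> ` I \<Longrightarrow> \<bar>x\<bar> < M"
    unfolding bounded_pos_less by (auto simp: )
  define a b where "a = - \<bar>M\<bar>" and "b = \<bar>M\<bar>"
  have E_sub: "E \<subseteq> {a..b}" "a \<notin> E" "b \<notin> E" using M unfolding a_def b_def by fastforce+
  have "((\<lambda>t. indicator E t * \<phi>' t) has_integral (W b - W a)) {a..b}"
  proof (rule fundamental_theorem_of_calculus_interior_strong[of "\<tau> ` I"])
    show "continuous_on {a..b} W" using W_cont continuous_at_imp_continuous_on by blast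
    show "(W has_vector_derivative indicator E x * \<phi>' x) (at x)" if "x \<in> {a<..<b} - \<tau> ` I" for x
      using W_deriv[of x] that by (simp add: has_real_derivative_iff_has_vector_derivative)
  qed (use I in \<open>auto simp: a_def b_def\<close>)
  then have "((\<lambda>t. indicator E t * \<phi>' t) has_integral (W b - W a)) UNIV"
    by (rule has_integral_on_superset) (use E_sub in \<open>auto simp: indicator_def\<close>)
  moreover have "integrable lborel (\<lambda>t. indicator E t * \<phi>' t)"
    using borel_integrable_compact[OF E continuous_on_subset[OF cont]] by (simp add: indicator_def)
  then have "((\<lambda>t. indicator E t * \<phi>' t) has_integral (LINT t|lborel. indicator E t * \<phi>' t)) UNIV"
    by (rule has_integral_integral_lborel)
  ultimately have "(LINT t|lborel. indicator E t * \<phi>' t) = W b - W a"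
    by (rule has_integral_unique[rotated])
  also have "c i a = 0 \<and> c i b = 1" if "i \<in> I" for i
    using M[of "\<tau> i"] that by (auto simp: c_def a_def b_def)
  then have "W b - W a = (\<Sum>i\<in>I. \<sigma> i * \<phi> (\<tau> i))"
    using E_sub by (simp add: W_def)
  finally show ?thesis .
qed

section \<open>Lebesgue measure in orthonormal coordinates\<close>

lemma nn_integral_lborel_translate:
  fixes f :: "'a::euclidean_space \<Rightarrow> ennreal"
  assumes [measurable]: "f \<in> borel_measurable borel"
  shows "(\<integral>\<^sup>+x. f (c + x) \<partial>lborel) = (\<integral>\<^sup>+x. f x \<partial>lborel)"
proof -
  have "(\<integral>\<^sup>+x. f x \<partial>lborel) = (\<integral>\<^sup>+x. f x \<partial>distr lborel borel ((+) c))"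
    by (simp add: lborel_distr_plus)
  also have "\<dots> = (\<integral>\<^sup>+x. f (c + x) \<partial>lborel)"
    by (subst nn_integral_distr) auto
  finally show ?thesis ..
qed

text \<open>
  Let $B$ be the unit ball. Evaluating
  $\iint 1_A(Tx)\, 1_B(y - Tx)\, dx\, dy$ by Tonelli's theorem in both orders, with a translation in
  each of them, gives $\lambda(T^{-1}A)\, \lambda(B) = \lambda(A)\, \lambda(B)$, because $T$ maps the
  symmetric set $B$ onto itself; and $0 < \lambda(B) < \infty$.
\<close>

lemma lborel_distr_orthogonal_transformation:
  fixes T :: "'a::euclidean_space \<Rightarrow> 'a"
  assumes T: "orthogonal_transformation T"
  shows "distr lborel borel T = lborel"
proof (rule measure_eqI)
  have lin: "linear T" using T by (rule orthogonal_transformation_linear)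
  have T_meas[measurable]: "T \<in> borel_measurable borel"
    using lin by (intro borel_measurable_continuous_onI linear_continuous_on) (simp add: linear_linear)
  fix A assume "A \<in> sets (distr lborel borel T)"
  then have A[measurable]: "A \<in> sets borel" by simp
  define B where "B = ball (0::'a) 1"
  have B[measurable]: "B \<in> sets borel" by (simp add: B_def)
  let ?I = "\<lambda>x y. indicator A (T x) * indicator B (y - T x) :: ennreal"
  have "(\<integral>\<^sup>+x. \<integral>\<^sup>+y. ?I x y \<partial>lborel \<partial>lborel) = (\<integral>\<^sup>+x. indicator A (T x) * emeasure lborel B \<partial>lborel)"
  proof (intro nn_integral_cong)
    fix x
    have "(\<integral>\<^sup>+y. ?I x y \<partial>lborel) = indicator A (T x) * (\<integral>\<^sup>+y. indicator B (- T x + y) \<partial>lborel)"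
      by (subst nn_integral_cmult) auto
    also have "(\<integral>\<^sup>+y. indicator B (- T x + y) \<partial>lborel) = emeasure lborel B"
      by (subst nn_integral_lborel_translate) auto
    finally show "(\<integral>\<^sup>+y. ?I x y \<partial>lborel) = indicator A (T x) * emeasure lborel B" .
  qed
  also have "\<dots> = emeasure lborel (T -` A) * emeasure lborel B"
  proof (subst nn_integral_multc)
    have "(\<integral>\<^sup>+x. indicator A (T x) \<partial>lborel) = (\<integral>\<^sup>+x. indicator (T -` A) x \<partial>lborel)"
      by (simp add: indicator_def)
    also have "\<dots> = emeasure lborel (T -` A)"
      using measurable_sets[OF T_meas A] by (subst nn_integral_indicator) auto
    finally show "(\<integral>\<^sup>+x. indicator A (T x) \<partial>lborel) * emeasure lborel B = emeasure lborel (T -` A) * emeasure lborel B"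
      by simp
  qed simp
  finally have 1: "(\<integral>\<^sup>+x. \<integral>\<^sup>+y. ?I x y \<partial>lborel \<partial>lborel) = emeasure lborel (T -` A) * emeasure lborel B" .
  have "(\<integral>\<^sup>+x. \<integral>\<^sup>+y. ?I x y \<partial>lborel \<partial>lborel) = (\<integral>\<^sup>+y. \<integral>\<^sup>+x. ?I x y \<partial>lborel \<partial>lborel)"
    by (rule lborel_pair.Fubini') measurable
  also have "\<dots> = (\<integral>\<^sup>+y. \<integral>\<^sup>+x. indicator A (T x + y) * indicator B x \<partial>lborel \<partial>lborel)"
  proof (rule nn_integral_cong)
    fix y
    \<comment> \<open>translating \<open>x\<close> by \<open>z\<close> replaces \<open>T x\<close> by \<open>T x + y\<close>\<close>
    obtain z where z: "T z = y" using orthogonal_transformation_surj[OF T] by (metis surjD)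
    have "(\<integral>\<^sup>+x. ?I x y \<partial>lborel) = (\<integral>\<^sup>+x. ?I (z + x) y \<partial>lborel)"
      by (rule nn_integral_lborel_translate[symmetric]) measurable
    also have "\<dots> = (\<integral>\<^sup>+x. indicator A (T x + y) * indicator B x \<partial>lborel)"
      using orthogonal_transformation_norm[OF T]
      by (intro nn_integral_cong) (simp add: linear_add[OF lin] z add.commute B_def indicator_def)
    finally show "(\<integral>\<^sup>+x. ?I x y \<partial>lborel) = (\<integral>\<^sup>+x. indicator A (T x + y) * indicator B x \<partial>lborel)" .
  qed
  also have "\<dots> = (\<integral>\<^sup>+x. \<integral>\<^sup>+y. indicator A (T x + y) * indicator B x \<partial>lborel \<partial>lborel)"
    by (rule lborel_pair.Fubini') measurable
  also have "\<dots> = (\<integral>\<^sup>+x. emeasure lborel A * indicator B x \<partial>lborel)"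
    by (intro nn_integral_cong, subst nn_integral_multc)
       (auto simp: nn_integral_lborel_translate[of "indicator A"])
  also have "\<dots> = emeasure lborel A * emeasure lborel B"
    by (simp add: nn_integral_cmult)
  finally have "emeasure lborel (T -` A) * emeasure lborel B = emeasure lborel A * emeasure lborel B"
    using 1 by simp
  moreover have "emeasure lborel B \<noteq> 0"
    unfolding B_def using open_not_negligible[of "ball (0::'a) 1"]
    by (auto simp: negligible_iff_null_sets null_sets_def)
  moreover have "emeasure lborel B \<noteq> top"
    unfolding B_def using emeasure_lborel_ball_finite[of "0::'a" 1] by simp
  ultimately have "emeasure lborel (T -` A) = emeasure lborel A"
    by (metis ennreal_mult_cancel_left mult.commute)
  then show "emeasure (distr lborel borel T) A = emeasure lborel A"
    by (simp add: emeasure_distr)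
qed simp

definition orthonormal_set :: "'a::real_inner set \<Rightarrow> bool" where
  "orthonormal_set C \<longleftrightarrow> pairwise orthogonal C \<and> (\<forall>c\<in>C. norm c = 1)"

lemma orthonormal_set_inner:
  assumes "orthonormal_set C" "c \<in> C" "c' \<in> C"
  shows "c \<bullet> c' = (if c = c' then 1 else 0)"
proof (cases "c = c'")
  case True
  then show ?thesis using assms by (simp add: orthonormal_set_def flip: norm_eq_1)
next
  case False
  then show ?thesis using assms by (auto simp: orthonormal_set_def pairwise_def orthogonal_def)
qed

lemma orthonormal_set_independent:
  fixes C :: "'a::euclidean_space set"
  assumes "orthonormal_set C" shows "independent C" "finite C"
proof -
  show "independent C"
    using assms by (intro pairwise_orthogonal_independent) (auto simp: orthonormal_set_def)
  then show "finite C" by (rule independent_imp_finite)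
qed

interpretation lborel_family: product_sigma_finite "\<lambda>_::'i. lborel :: real measure"
  by (rule product_sigma_finite.intro) (rule sigma_finite_lborel)

text \<open>
  The orthogonal map that sends the standard basis to $C$ reduces the coordinates with respect to $C$ to
  the standard ones.
\<close>

lemma distr_inner_orthonormal_set:
  fixes C :: "'a::euclidean_space set"
  assumes C: "orthonormal_set C" and card: "card C = DIM('a)"
  shows "distr lborel (\<Pi>\<^sub>M c\<in>C. lborel) (\<lambda>x. \<lambda>c\<in>C. x \<bullet> c) = (\<Pi>\<^sub>M c\<in>C. lborel)"
    (is "distr lborel ?P ?g = ?P")
proof (rule lborel_family.PiM_eqI)
  show fin: "finite C" using orthonormal_set_independent(2)[OF C] .
  show "sets (distr lborel ?P ?g) = sets ?P" by simp
  have "card (Basis :: ('a) set) = card C" using card by simp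
  then obtain \<iota> where \<iota>: "bij_betw \<iota> (Basis :: ('a) set) C"
    using fin finite_same_card_bij finite_Basis by blast
  have \<iota>_mem: "\<iota> b \<in> C" if "b \<in> Basis" for b using \<iota> that bij_betwE by blast
  define T where "T x = (\<Sum>b\<in>Basis. (x \<bullet> b) *\<^sub>R \<iota> b)" for x :: "'a"
  have \<iota>_inner: "\<iota> b \<bullet> \<iota> b' = (if b = b' then 1 else 0)" if "b \<in> Basis" "b' \<in> Basis" for b b'
    using orthonormal_set_inner[OF C \<iota>_mem[OF that(1)] \<iota>_mem[OF that(2)]] \<iota> that
    by (auto simp: bij_betw_def inj_on_def)
  have T_inner: "T x \<bullet> \<iota> b = x \<bullet> b" if "b \<in> Basis" for x b
    using that by (simp add: T_def inner_sum_left \<iota>_inner if_distrib[of "\<lambda>t. _ * t"] cong: if_cong)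
  have T: "orthogonal_transformation T"
    unfolding orthogonal_transformation_def
  proof (intro conjI allI)
    show "linear T" unfolding T_def[abs_def]
      by (intro linear_compose_sum ballI linearI) (auto simp: inner_left_distrib scaleR_add_left)
    fix x y
    have "T x \<bullet> T y = (\<Sum>b\<in>Basis. (y \<bullet> b) * (T x \<bullet> \<iota> b))"
      by (subst (2) T_def) (simp add: inner_sum_right)
    also have "\<dots> = x \<bullet> y" by (subst (3) euclidean_inner) (simp add: T_inner mult.commute)
    finally show "T x \<bullet> T y = x \<bullet> y" .
  qed
  have T_meas[measurable]: "T \<in> borel_measurable borel"
    unfolding T_def[abs_def] by measurable
  have g_meas: "?g \<in> lborel \<rightarrow>\<^sub>M ?P"
    by (intro measurable_restrict) simp
  fix A :: "'a \<Rightarrow> real set" assume A: "\<And>c. c \<in> C \<Longrightarrow> A c \<in> sets lborel"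
  have PiE: "Pi\<^sub>E C A \<in> sets ?P" using fin A by (intro sets_PiM_I_finite) auto
  define S where "S = ?g -` Pi\<^sub>E C A \<inter> space lborel"
  have S: "S \<in> sets borel" unfolding S_def using measurable_sets[OF g_meas PiE] by simp
  have S_eq: "x \<in> S \<longleftrightarrow> (\<forall>c\<in>C. x \<bullet> c \<in> A c)" for x by (auto simp: S_def)
  have S_T: "T x \<in> S \<longleftrightarrow> (\<forall>b\<in>Basis. x \<bullet> b \<in> A (\<iota> b))" for x
    using \<iota> unfolding S_eq by (auto simp: bij_betw_def T_inner)
  let ?P' = "\<Pi>\<^sub>M b\<in>(Basis :: ('a) set). (lborel :: real measure)"
  let ?r = "\<lambda>f. \<Sum>b\<in>Basis. f b *\<^sub>R b :: 'a"
  have r_meas: "?r \<in> borel_measurable ?P'" by measurable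
  have "emeasure (distr lborel ?P ?g) (Pi\<^sub>E C A) = emeasure lborel S"
    using emeasure_distr[OF g_meas PiE] by (simp add: S_def)
  also have "\<dots> = emeasure (distr lborel borel T) S"
    by (simp add: lborel_distr_orthogonal_transformation[OF T])
  also have "\<dots> = emeasure lborel (T -` S)" using S by (subst emeasure_distr) auto
  also have "\<dots> = emeasure (distr ?P' borel ?r) (T -` S)" by (simp flip: lborel_eq)
  also have "\<dots> = emeasure ?P' (?r -` (T -` S) \<inter> space ?P')"
    using S measurable_sets[OF T_meas S] by (subst emeasure_distr[OF r_meas]) auto
  also have "?r -` (T -` S) \<inter> space ?P' = Pi\<^sub>E Basis (\<lambda>b. A (\<iota> b))"
    by (auto simp: S_T space_PiM PiE_iff inner_sum_left inner_Basis if_distrib[of "\<lambda>t. _ * t"] cong: if_cong)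
  also have "emeasure ?P' \<dots> = (\<Prod>b\<in>Basis. emeasure lborel (A (\<iota> b)))"
    using A \<iota>_mem by (intro lborel_family.emeasure_PiM) auto
  also have "\<dots> = (\<Prod>c\<in>C. emeasure lborel (A c))"
    by (rule prod.reindex_bij_betw[OF \<iota>])
  finally show "emeasure (distr lborel ?P ?g) (Pi\<^sub>E C A) = (\<Prod>c\<in>C. emeasure lborel (A c))" .
qed

lemma orthonormal_expansion:
  fixes C :: "'a::euclidean_space set"
  assumes C: "orthonormal_set C" and card: "card C = DIM('a)"
  shows "(\<Sum>c\<in>C. (x \<bullet> c) *\<^sub>R c) = x"
proof -
  have span: "span C = UNIV"
    using card_ge_dim_independent[of C UNIV] orthonormal_set_independent[OF C] card by auto
  define z where "z = x - (\<Sum>c\<in>C. (x \<bullet> c) *\<^sub>R c)"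
  have "orthogonal z c" if "c \<in> C" for c
    using orthonormal_set_independent(2)[OF C] that
    by (simp add: z_def orthogonal_def inner_diff_left inner_sum_left orthonormal_set_inner[OF C]
        if_distrib[of "\<lambda>t. _ * t"] cong: if_cong)
  then have "orthogonal z z"
    using orthogonal_to_span[of z C z] span by simp
  then show ?thesis by (simp add: z_def orthogonal_self)
qed

lemma lborel_eq_distr_orthonormal_set:
  fixes C :: "'a::euclidean_space set"
  assumes C: "orthonormal_set C" and card: "card C = DIM('a)"
  shows "lborel = distr (\<Pi>\<^sub>M c\<in>C. lborel) borel (\<lambda>s. \<Sum>c\<in>C. s c *\<^sub>R c)"
proof -
  have "distr (\<Pi>\<^sub>M c\<in>C. lborel) borel (\<lambda>s. \<Sum>c\<in>C. s c *\<^sub>R c)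
      = distr lborel borel ((\<lambda>s. \<Sum>c\<in>C. s c *\<^sub>R c) \<circ> (\<lambda>x. \<lambda>c\<in>C. x \<bullet> c))"
    by (subst distr_inner_orthonormal_set[OF assms, symmetric], subst distr_distr)
       (auto intro!: measurable_restrict)
  also have "(\<lambda>s. \<Sum>c\<in>C. s c *\<^sub>R c) \<circ> (\<lambda>x. \<lambda>c\<in>C. x \<bullet> c) = (\<lambda>x. x)"
    using orthonormal_expansion[OF assms] by (simp add: fun_eq_iff)
  finally show ?thesis by (simp add: distr_id2)
qed

text \<open>
  Tonelli's theorem in the coordinates of the hyperplane through $x_0$ with normal $\nu$: one coordinate
  along $\nu$ and the others along an orthonormal basis $B$ of the directions of the hyperplane.
\<close>

lemma nn_integral_lborel_hyperplane_coordinates: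
  fixes B :: "'a::euclidean_space set" and f :: "'a \<Rightarrow> ennreal"
  assumes C: "orthonormal_set (insert \<nu> B)" "\<nu> \<notin> B" and card: "card (insert \<nu> B) = DIM('a)"
    and f[measurable]: "f \<in> borel_measurable borel"
  shows "(\<integral>\<^sup>+x. f x \<partial>lborel) =
    (\<integral>\<^sup>+\<tau>. \<integral>\<^sup>+s. f (x\<^sub>0 + (\<Sum>b\<in>B. s b *\<^sub>R b) + \<tau> *\<^sub>R \<nu>) \<partial>(\<Pi>\<^sub>M b\<in>B. lborel) \<partial>lborel)"
proof -
  have fin: "finite B" using orthonormal_set_independent(2)[OF C(1)] by simp
  have "(\<integral>\<^sup>+x. f x \<partial>lborel) = (\<integral>\<^sup>+x. f (x\<^sub>0 + x) \<partial>lborel)"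
    by (simp add: nn_integral_lborel_translate)
  also have "\<dots> = (\<integral>\<^sup>+s. f (x\<^sub>0 + (\<Sum>c\<in>insert \<nu> B. s c *\<^sub>R c)) \<partial>(\<Pi>\<^sub>M c\<in>insert \<nu> B. lborel))"
    by (subst lborel_eq_distr_orthonormal_set[OF C(1) card], subst nn_integral_distr) auto
  also have "\<dots> = (\<integral>\<^sup>+\<tau>. \<integral>\<^sup>+s. f (x\<^sub>0 + (\<Sum>c\<in>insert \<nu> B. (s(\<nu> := \<tau>)) c *\<^sub>R c)) \<partial>(\<Pi>\<^sub>M b\<in>B. lborel) \<partial>lborel)"
    by (rule lborel_family.product_nn_integral_insert_rev[OF fin C(2)]) measurable
  also have "\<dots> = (\<integral>\<^sup>+\<tau>. \<integral>\<^sup>+s. f (x\<^sub>0 + (\<Sum>b\<in>B. s b *\<^sub>R b) + \<tau> *\<^sub>R \<nu>) \<partial>(\<Pi>\<^sub>M b\<in>B. lborel) \<partial>lborel)"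
  proof -
    have "(\<Sum>c\<in>insert \<nu> B. (s(\<nu> := \<tau>)) c *\<^sub>R c) = \<tau> *\<^sub>R \<nu> + (\<Sum>b\<in>B. s b *\<^sub>R b)" for s \<tau>
      using fin C(2) by (auto intro!: sum.cong)
    then show ?thesis by (simp only: ac_simps)
  qed
  finally show ?thesis .
qed

lemma nn_integral_PiM_lborel_translate:
  fixes f :: "('i \<Rightarrow> real) \<Rightarrow> ennreal"
  assumes fin: "finite B" and f[measurable]: "f \<in> borel_measurable (\<Pi>\<^sub>M b\<in>B. lborel)"
  shows "(\<integral>\<^sup>+s. f (\<lambda>b\<in>B. \<omega> b + s b) \<partial>(\<Pi>\<^sub>M b\<in>B. lborel)) = (\<integral>\<^sup>+s. f s \<partial>(\<Pi>\<^sub>M b\<in>B. lborel))"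
proof -
  let ?P = "\<Pi>\<^sub>M b\<in>B. (lborel :: real measure)" and ?t = "\<lambda>s. \<lambda>b\<in>B. \<omega> b + s b"
  have t[measurable]: "?t \<in> ?P \<rightarrow>\<^sub>M ?P" by (intro measurable_restrict) measurable
  have "distr ?P ?P ?t = ?P"
  proof (rule lborel_family.PiM_eqI[OF fin])
    fix A :: "'i \<Rightarrow> real set" assume A: "\<And>i. i \<in> B \<Longrightarrow> A i \<in> sets lborel"
    have sh: "(\<lambda>x. \<omega> i + x) -` A i \<in> sets borel" if "i \<in> B" for i
      using measurable_sets[of "\<lambda>x. \<omega> i + x" borel borel "A i"] A[OF that] by simp
    have "emeasure (distr ?P ?P ?t) (Pi\<^sub>E B A) = emeasure ?P (?t -` Pi\<^sub>E B A \<inter> space ?P)"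
      using A fin by (intro emeasure_distr[OF t] sets_PiM_I_finite) auto
    also have "?t -` Pi\<^sub>E B A \<inter> space ?P = (\<Pi>\<^sub>E i\<in>B. (\<lambda>x. \<omega> i + x) -` A i)"
      by (auto simp: space_PiM PiE_iff)
    also have "emeasure ?P \<dots> = (\<Prod>i\<in>B. emeasure lborel ((\<lambda>x. \<omega> i + x) -` A i))"
      using sh fin by (intro lborel_family.emeasure_PiM) auto
    also have "\<dots> = (\<Prod>i\<in>B. emeasure lborel (A i))"
    proof (intro prod.cong refl)
      fix i assume "i \<in> B"
      then have "emeasure (distr lborel borel ((+) (\<omega> i))) (A i) = emeasure lborel ((\<lambda>x. \<omega> i + x) -` A i)"
        using A by (subst emeasure_distr) auto
      then show "emeasure lborel ((\<lambda>x. \<omega> i + x) -` A i) = emeasure lborel (A i)"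
        by (simp add: lborel_distr_plus)
    qed
    finally show "emeasure (distr ?P ?P ?t) (Pi\<^sub>E B A) = (\<Prod>i\<in>B. emeasure lborel (A i))" .
  qed simp
  then have "(\<integral>\<^sup>+s. f s \<partial>?P) = (\<integral>\<^sup>+s. f s \<partial>distr ?P ?P ?t)" by simp
  also have "\<dots> = (\<integral>\<^sup>+s. f (?t s) \<partial>?P)" by (rule nn_integral_distr[OF t]) measurable
  finally show ?thesis ..
qed

section \<open>Integration along parallel lines\<close>

lemma sets_affine_lborel[measurable_cong]: "sets (affine_lborel F) = sets borel"
  by (simp add: affine_lborel_def Let_def)

text \<open>
  The choices inside \<open>affine_lborel\<close> are legitimate, and the chosen basis of the directions of
  \<open>F\<close>, completed by the unit normal, is an orthonormal basis of the whole space.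
\<close>

lemma affine_lborel_coordinates:
  fixes F :: "'a::euclidean_space set"
  assumes F: "F \<noteq> {}" "aff_dim F = int DIM('a) - 1"
    and \<nu>: "norm \<nu> = 1" "\<And>x y. x \<in> F \<Longrightarrow> y \<in> F \<Longrightarrow> \<nu> \<bullet> (x - y) = 0"
  obtains x\<^sub>0 B where "x\<^sub>0 \<in> F" "orthonormal_set (insert \<nu> B)" "\<nu> \<notin> B" "card (insert \<nu> B) = DIM('a)"
    "affine_lborel F = distr (\<Pi>\<^sub>M b\<in>B. lborel) borel (\<lambda>s. x\<^sub>0 + (\<Sum>b\<in>B. s b *\<^sub>R b))"
proof -
  define D where "D = {x - y | x y. x \<in> F \<and> y \<in> F}"
  define x\<^sub>0 where "x\<^sub>0 = (SOME x. x \<in> F)"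
  define P where "P B \<longleftrightarrow> pairwise orthogonal B \<and> (\<forall>b\<in>B. norm b = 1) \<and> span B = span D" for B
  define B where "B = (SOME B. P B)"
  have x\<^sub>0: "x\<^sub>0 \<in> F" using F(1) unfolding x\<^sub>0_def by (simp add: some_in_eq)
  have "\<exists>B. P B"
    unfolding P_def using orthonormal_basis_subspace[OF subspace_span[of D]] by metis
  then have "P B" unfolding B_def by (rule someI_ex)
  then have B: "orthonormal_set B" and span: "span B = span D"
    by (auto simp: P_def orthonormal_set_def)
  have "orthogonal \<nu> b" if "b \<in> B" for b
  proof (rule orthogonal_to_span)
    show "b \<in> span D" using that span span_base by blast
    show "orthogonal \<nu> y" if "y \<in> D" for y using that \<nu>(2) by (auto simp: D_def orthogonal_def)
  qed
  note orth = this
  have C: "orthonormal_set (insert \<nu> B)"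
    using B orth \<nu>(1) by (auto simp: orthonormal_set_def pairwise_insert orthogonal_commute)
  have notin: "\<nu> \<notin> B"
    using orth[of \<nu>] \<nu>(1) by (auto simp: orthogonal_self)
  have fin: "finite B" using orthonormal_set_independent(2)[OF B] .
  have "int DIM('a) - 1 = int (dim ((\<lambda>x. x - x\<^sub>0) ` F))"
    using F(2) aff_dim_eq_dim_subtract[of x\<^sub>0 F] hull_inc[OF x\<^sub>0] by simp
  also have "dim ((\<lambda>x. x - x\<^sub>0) ` F) \<le> dim D"
    by (rule dim_subset) (use x\<^sub>0 in \<open>unfold D_def, blast\<close>)
  also have "dim D = card B"
    using span orthonormal_set_independent(1)[OF B] by (metis dim_eq_card dim_span)
  finally have ge: "DIM('a) \<le> card B + 1" by simp
  have "card (insert \<nu> B) \<le> DIM('a)"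
    using orthonormal_set_independent[OF C] independent_bound by blast
  then have "card (insert \<nu> B) = DIM('a)" using ge fin notin by simp
  moreover have "affine_lborel F = distr (\<Pi>\<^sub>M b\<in>B. lborel) borel (\<lambda>s. x\<^sub>0 + (\<Sum>b\<in>B. s b *\<^sub>R b))"
    unfolding affine_lborel_def Let_def x\<^sub>0_def B_def P_def D_def ..
  ultimately show ?thesis by (intro that[OF x\<^sub>0 C notin])
qed

text \<open>
  The strip has width one along each line in the direction of the unit vector \<open>v\<close>; restricting to it
  counts every such line with weight one.
\<close>

definition strip :: "'a::euclidean_space \<Rightarrow> 'a set" where
  "strip v = {x. 0 \<le> v \<bullet> x \<and> v \<bullet> x < 1}"

lemma strip_sets[measurable]: "strip v \<in> sets borel"
  unfolding strip_def by measurable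

text \<open>
  For $\nu \cdot v \neq 0$, the point where the line through \<open>x\<close> in direction \<open>v\<close> meets the hyperplane through
  \<open>x\<^sub>0\<close> with normal \<open>\<nu>\<close>.
\<close>

definition oblique_projection :: "'a::euclidean_space \<Rightarrow> 'a \<Rightarrow> 'a \<Rightarrow> 'a \<Rightarrow> 'a" where
  "oblique_projection v \<nu> x\<^sub>0 x = x - (\<nu> \<bullet> (x - x\<^sub>0) / (\<nu> \<bullet> v)) *\<^sub>R v"

lemma oblique_projection_measurable[measurable]:
  "oblique_projection v \<nu> x\<^sub>0 \<in> borel_measurable borel"
  unfolding oblique_projection_def[abs_def] by measurable

lemma nn_integral_strip_line:
  assumes v: "norm v = 1" and c: "c \<noteq> 0"
  shows "(\<integral>\<^sup>+t. indicator (strip v) (x + (t / c) *\<^sub>R v) \<partial>lborel) = ennreal \<bar>c\<bar>"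
proof -
  have "v \<bullet> v = 1" using v by (simp flip: norm_eq_1)
  then have *: "indicator (strip v) (x + (t / c) *\<^sub>R v) = (indicator {0..<1} (v \<bullet> x + (1 / c) * t) :: ennreal)" for t
    by (simp add: indicator_def strip_def inner_add_right)
  have "(\<integral>\<^sup>+t. indicator {0..<1::real} t \<partial>lborel) =
      ennreal \<bar>1 / c\<bar> * (\<integral>\<^sup>+t. indicator {0..<1::real} (v \<bullet> x + (1 / c) * t) \<partial>lborel)"
    using c by (subst nn_integral_real_affine[of _ "1 / c" "v \<bullet> x"]) auto
  moreover have "(\<integral>\<^sup>+t. indicator {0..<1::real} t \<partial>lborel) = 1" by simp
  ultimately have "ennreal \<bar>c\<bar> = (ennreal \<bar>c\<bar> * ennreal \<bar>1 / c\<bar>) * (\<integral>\<^sup>+t. indicator {0..<1::real} (v \<bullet> x + (1 / c) * t) \<partial>lborel)"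
    by (metis mult.assoc mult.right_neutral)
  also have "ennreal \<bar>c\<bar> * ennreal \<bar>1 / c\<bar> = 1"
    using c by (simp flip: ennreal_mult add: abs_mult[symmetric])
  finally show ?thesis unfolding * by simp
qed

text \<open>
  Surface measure on $F$ is the image of the lines in direction $v$, up to the Jacobian
  $|\nu \cdot v|$. Split $x = y + \tau\nu$ with $y$ in the hyperplane of $F$. The projection along $v$ maps
  $x$ to $y + \tau w$ with $w = \nu - v / (\nu \cdot v)$, which is parallel to the hyperplane. For fixed
  $\tau$, translation invariance within the hyperplane replaces $y + \tau w$ by $y$. The remaining
  integral over $\tau$ measures the set where $y + (\tau / (\nu \cdot v)) v$ lies in the strip, an interval
  of length $|\nu \cdot v|$.
\<close>

lemma distr_strip_oblique_projection:
  fixes F :: "'a::euclidean_space set"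
  assumes F: "aff_dim F = int DIM('a) - 1" "x\<^sub>1 \<in> F"
    and \<nu>: "norm \<nu> = 1" "\<And>x y. x \<in> F \<Longrightarrow> y \<in> F \<Longrightarrow> \<nu> \<bullet> (x - y) = 0"
    and v: "norm v = 1" and c: "\<nu> \<bullet> v \<noteq> 0"
  shows "distr (restrict_space lborel (strip v)) borel (oblique_projection v \<nu> x\<^sub>1)
    = density (affine_lborel F) (\<lambda>_. ennreal \<bar>\<nu> \<bullet> v\<bar>)"
proof (rule measure_eqI)
  have ne: "F \<noteq> {}" using F(2) by blast
  obtain x\<^sub>0 B where x\<^sub>0: "x\<^sub>0 \<in> F" and C: "orthonormal_set (insert \<nu> B)" "\<nu> \<notin> B"
    and card: "card (insert \<nu> B) = DIM('a)"
    and aff: "affine_lborel F = distr (\<Pi>\<^sub>M b\<in>B. lborel) borel (\<lambda>s. x\<^sub>0 + (\<Sum>b\<in>B. s b *\<^sub>R b))"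
    by (rule affine_lborel_coordinates[OF ne F(1) \<nu>])
  have fin[simp]: "finite B" using orthonormal_set_independent(2)[OF C(1)] by simp
  show "sets (distr (restrict_space lborel (strip v)) borel (oblique_projection v \<nu> x\<^sub>1))
      = sets (density (affine_lborel F) (\<lambda>_. ennreal \<bar>\<nu> \<bullet> v\<bar>))"
    by (simp add: aff)
  fix A assume "A \<in> sets (distr (restrict_space lborel (strip v)) borel (oblique_projection v \<nu> x\<^sub>1))"
  then have A[measurable]: "A \<in> sets borel" by simp
  let ?c = "\<nu> \<bullet> v" and ?P = "\<Pi>\<^sub>M b\<in>B. (lborel :: real measure)"
  define \<pi> where "\<pi> = oblique_projection v \<nu> x\<^sub>1"
  have [measurable]: "\<pi> \<in> borel_measurable borel" by (simp add: \<pi>_def)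
  define w where "w = \<nu> - (1 / ?c) *\<^sub>R v"
  define \<kappa> where "\<kappa> s = x\<^sub>0 + (\<Sum>b\<in>B. s b *\<^sub>R b)" for s
  have [measurable]: "\<kappa> \<in> borel_measurable ?P" unfolding \<kappa>_def[abs_def] by measurable
  have \<nu>_B: "\<nu> \<bullet> b = 0" if "b \<in> B" for b
    using orthonormal_set_inner[OF C(1), of \<nu> b] that C(2) by auto
  have \<nu>_\<nu>: "\<nu> \<bullet> \<nu> = 1" using \<nu>(1) by (simp flip: norm_eq_1)
  have w_\<nu>: "w \<bullet> \<nu> = 0"
    using c \<nu>_\<nu> by (simp add: w_def inner_diff_left inner_commute[of v \<nu>])
  have w: "(\<Sum>b\<in>B. (w \<bullet> b) *\<^sub>R b) = w"
    using orthonormal_expansion[OF C(1) card, of w] C(2) w_\<nu> by simp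
  have \<kappa>_\<nu>: "\<nu> \<bullet> (\<kappa> s - x\<^sub>1) = 0" for s
    using \<nu>(2)[OF x\<^sub>0 F(2)] \<nu>_B
    by (simp add: \<kappa>_def inner_diff_right inner_add_right inner_sum_right)
  have \<kappa>_shift: "\<kappa> (\<lambda>b\<in>B. \<tau> * (w \<bullet> b) + s b) = \<kappa> s + \<tau> *\<^sub>R w" for s \<tau>
  proof -
    have "(\<Sum>b\<in>B. (\<tau> * (w \<bullet> b) + s b) *\<^sub>R b) = \<tau> *\<^sub>R (\<Sum>b\<in>B. (w \<bullet> b) *\<^sub>R b) + (\<Sum>b\<in>B. s b *\<^sub>R b)"
      by (simp add: scaleR_add_left sum.distrib scaleR_sum_right)
    then show ?thesis by (simp add: \<kappa>_def w)
  qed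
  have \<pi>_\<kappa>: "\<pi> (\<kappa> s + \<tau> *\<^sub>R \<nu>) = \<kappa> s + \<tau> *\<^sub>R w" for s \<tau>
  proof -
    have "\<nu> \<bullet> (\<kappa> s + \<tau> *\<^sub>R \<nu> - x\<^sub>1) = \<tau>"
      using \<kappa>_\<nu>[of s] \<nu>_\<nu> by (simp add: inner_diff_right inner_add_right)
    then show ?thesis
      by (simp add: \<pi>_def oblique_projection_def w_def algebra_simps)
  qed
  have split: "\<kappa> s + \<tau> *\<^sub>R \<nu> = \<kappa> s + \<tau> *\<^sub>R w + (\<tau> / ?c) *\<^sub>R v" for s \<tau>
    by (simp add: w_def algebra_simps)
  let ?K = "\<lambda>\<tau> s. indicator (strip v) (\<kappa> s + (\<tau> / ?c) *\<^sub>R v) * indicator A (\<kappa> s) :: ennreal"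
  have "emeasure (distr (restrict_space lborel (strip v)) borel \<pi>) A
      = emeasure (restrict_space lborel (strip v)) (\<pi> -` A \<inter> strip v)"
    by (subst emeasure_distr) (auto intro!: measurable_restrict_space1 simp: space_restrict_space)
  also have "\<dots> = emeasure lborel (\<pi> -` A \<inter> strip v)"
    using measurable_sets[of \<pi> borel borel A] by (subst emeasure_restrict_space) auto
  also have "\<dots> = (\<integral>\<^sup>+x. indicator (strip v) x * indicator A (\<pi> x) \<partial>lborel)"
  proof -
    have "\<pi> -` A \<inter> strip v \<in> sets lborel"
      using measurable_sets[of \<pi> borel borel A] by simp
    from nn_integral_indicator[OF this] have "emeasure lborel (\<pi> -` A \<inter> strip v)
        = (\<integral>\<^sup>+x. indicator (\<pi> -` A \<inter> strip v) x \<partial>lborel)" ..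
    also have "\<dots> = (\<integral>\<^sup>+x. indicator (strip v) x * indicator A (\<pi> x) \<partial>lborel)"
      by (intro nn_integral_cong) (auto simp: indicator_def)
    finally show ?thesis .
  qed
  also have "\<dots> = (\<integral>\<^sup>+\<tau>. \<integral>\<^sup>+s. indicator (strip v) (\<kappa> s + \<tau> *\<^sub>R \<nu>) * indicator A (\<pi> (\<kappa> s + \<tau> *\<^sub>R \<nu>)) \<partial>?P \<partial>lborel)"
    unfolding \<kappa>_def
    by (rule nn_integral_lborel_hyperplane_coordinates[OF C card, where f="\<lambda>x. indicator (strip v) x * indicator A (\<pi> x)"])
       measurable
  also have "\<dots> = (\<integral>\<^sup>+\<tau>. \<integral>\<^sup>+s. ?K \<tau> (\<lambda>b\<in>B. \<tau> * (w \<bullet> b) + s b) \<partial>?P \<partial>lborel)"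
    unfolding \<kappa>_shift \<pi>_\<kappa> unfolding split ..
  also have "\<dots> = (\<integral>\<^sup>+\<tau>. \<integral>\<^sup>+s. ?K \<tau> s \<partial>?P \<partial>lborel)"
  proof (rule nn_integral_cong)
    fix \<tau> :: real
    show "(\<integral>\<^sup>+s. ?K \<tau> (\<lambda>b\<in>B. \<tau> * (w \<bullet> b) + s b) \<partial>?P) = (\<integral>\<^sup>+s. ?K \<tau> s \<partial>?P)"
      by (rule nn_integral_PiM_lborel_translate[OF fin, where f="?K \<tau>" and \<omega>="\<lambda>b. \<tau> * (w \<bullet> b)"]) measurable
  qed
  also have "\<dots> = (\<integral>\<^sup>+s. \<integral>\<^sup>+\<tau>. ?K \<tau> s \<partial>lborel \<partial>?P)"
    by (rule pair_sigma_finite.Fubini'[symmetric])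
       (auto intro!: pair_sigma_finite.intro lborel_family.sigma_finite sigma_finite_lborel)
  also have "\<dots> = (\<integral>\<^sup>+s. ennreal \<bar>?c\<bar> * indicator A (\<kappa> s) \<partial>?P)"
    by (rule nn_integral_cong, subst nn_integral_multc) (auto simp: nn_integral_strip_line[OF v c])
  also have "\<dots> = ennreal \<bar>?c\<bar> * (\<integral>\<^sup>+s. indicator A (\<kappa> s) \<partial>?P)"
    by (rule nn_integral_cmult) measurable
  also have "(\<integral>\<^sup>+s. indicator A (\<kappa> s) \<partial>?P) = (\<integral>\<^sup>+x. indicator A x \<partial>distr ?P borel \<kappa>)"
    by (rule nn_integral_distr[symmetric]) measurable
  also have "\<dots> = emeasure (affine_lborel F) A"
    unfolding aff \<kappa>_def[abs_def] by (subst nn_integral_indicator) auto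
  finally show "emeasure (distr (restrict_space lborel (strip v)) borel (oblique_projection v \<nu> x\<^sub>1)) A
      = emeasure (density (affine_lborel F) (\<lambda>_. ennreal \<bar>?c\<bar>)) A"
    by (subst emeasure_density_const) (auto simp: \<pi>_def sets_affine_lborel)
qed

lemma strip_line_measurable:
  "(\<lambda>(x, t). x + t *\<^sub>R v) \<in> restrict_space lborel (strip v) \<Otimes>\<^sub>M lborel \<rightarrow>\<^sub>M borel"
proof -
  let ?M = "restrict_space lborel (strip v) \<Otimes>\<^sub>M (lborel :: real measure)"
  have "(\<lambda>x. x) \<in> restrict_space lborel (strip v) \<rightarrow>\<^sub>M borel"
    by (intro measurable_restrict_space1) simp
  then have "(\<lambda>z. fst z) \<in> ?M \<rightarrow>\<^sub>M borel" by (rule measurable_compose[OF measurable_fst])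
  moreover have "(\<lambda>z. snd z) \<in> ?M \<rightarrow>\<^sub>M borel"
    by (rule measurable_compose[OF measurable_snd]) simp
  ultimately show ?thesis
    unfolding case_prod_beta by (intro borel_measurable_add borel_measurable_scaleR) simp_all
qed

text \<open>
  After Tonelli's theorem and a translation by $t v$, the inner integral is the length of the part of a
  line inside the strip, which is one.
\<close>

lemma distr_strip_lines:
  fixes v :: "'a::euclidean_space"
  assumes v: "norm v = 1"
  shows "distr (restrict_space lborel (strip v) \<Otimes>\<^sub>M lborel) borel (\<lambda>(x, t). x + t *\<^sub>R v) = lborel"
    (is "distr (?S \<Otimes>\<^sub>M _) _ ?q = _")
proof (rule measure_eqI)
  fix A assume "A \<in> sets (distr (?S \<Otimes>\<^sub>M lborel) borel ?q)"
  then have A[measurable]: "A \<in> sets borel" by simp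
  interpret S: sigma_finite_measure ?S
    by (intro sigma_finite_measure_restrict_space sigma_finite_lborel) simp
  interpret P: pair_sigma_finite ?S lborel ..
  have q[measurable]: "?q \<in> ?S \<Otimes>\<^sub>M lborel \<rightarrow>\<^sub>M borel" by (rule strip_line_measurable)
  have "emeasure (distr (?S \<Otimes>\<^sub>M lborel) borel ?q) A = (\<integral>\<^sup>+z. indicator A (?q z) \<partial>(?S \<Otimes>\<^sub>M lborel))"
  proof -
    have "(\<integral>\<^sup>+z. indicator A (?q z) \<partial>(?S \<Otimes>\<^sub>M lborel)) = (\<integral>\<^sup>+x. indicator A x \<partial>distr (?S \<Otimes>\<^sub>M lborel) borel ?q)"
      by (rule nn_integral_distr[OF q, symmetric]) simp
    then show ?thesis by simp
  qed
  also have "\<dots> = (\<integral>\<^sup>+x. \<integral>\<^sup>+t. indicator A (x + t *\<^sub>R v) \<partial>lborel \<partial>?S)"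
    by (subst lborel.nn_integral_fst[symmetric]) auto
  also have "\<dots> = (\<integral>\<^sup>+x. \<integral>\<^sup>+t. indicator (strip v) x * indicator A (t *\<^sub>R v + x) \<partial>lborel \<partial>lborel)"
    by (subst nn_integral_restrict_space)
       (auto simp: nn_integral_cmult mult.commute add.commute intro!: nn_integral_cong)
  also have "\<dots> = (\<integral>\<^sup>+t. \<integral>\<^sup>+x. indicator (strip v) x * indicator A (t *\<^sub>R v + x) \<partial>lborel \<partial>lborel)"
    by (rule lborel_pair.Fubini') measurable
  also have "\<dots> = (\<integral>\<^sup>+t. \<integral>\<^sup>+x. indicator (strip v) (x + (t / -1) *\<^sub>R v) * indicator A x \<partial>lborel \<partial>lborel)"
  proof (rule nn_integral_cong)
    fix t :: real
    have "(\<integral>\<^sup>+x. indicator (strip v) (t *\<^sub>R v + x + (t / -1) *\<^sub>R v) * indicator A (t *\<^sub>R v + x) \<partial>lborel)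
        = (\<integral>\<^sup>+x. indicator (strip v) (x + (t / -1) *\<^sub>R v) * indicator A x \<partial>lborel)"
      by (rule nn_integral_lborel_translate[of "\<lambda>x. indicator (strip v) (x + (t / -1) *\<^sub>R v) * indicator A x"]) measurable
    then show "(\<integral>\<^sup>+x. indicator (strip v) x * indicator A (t *\<^sub>R v + x) \<partial>lborel)
        = (\<integral>\<^sup>+x. indicator (strip v) (x + (t / -1) *\<^sub>R v) * indicator A x \<partial>lborel)"
      by simp
  qed
  also have "\<dots> = (\<integral>\<^sup>+x. \<integral>\<^sup>+t. indicator (strip v) (x + (t / -1) *\<^sub>R v) * indicator A x \<partial>lborel \<partial>lborel)"
    by (rule lborel_pair.Fubini') measurable
  also have "\<dots> = (\<integral>\<^sup>+x. indicator A x \<partial>lborel)"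
    by (rule nn_integral_cong, subst nn_integral_multc)
       (auto simp: nn_integral_strip_line[OF v, of "-1", simplified])
  finally show "emeasure (distr (?S \<Otimes>\<^sub>M lborel) borel ?q) A = emeasure lborel A" by simp
qed simp

lemma integral_over_strip_of_line_integrals:
  fixes v :: "'a::euclidean_space" and g :: "'a \<Rightarrow> real"
  assumes v: "norm v = 1" and g: "integrable lborel g"
  shows "(LINT x|lborel. g x) = (LINT x|restrict_space lborel (strip v). LINT t|lborel. g (x + t *\<^sub>R v))"
proof -
  let ?S = "restrict_space lborel (strip v)" and ?q = "\<lambda>(x, t). x + t *\<^sub>R v"
  interpret S: sigma_finite_measure ?S
    by (intro sigma_finite_measure_restrict_space sigma_finite_lborel) simp
  interpret P: pair_sigma_finite ?S lborel ..
  have q[measurable]: "?q \<in> ?S \<Otimes>\<^sub>M lborel \<rightarrow>\<^sub>M borel" by (rule strip_line_measurable)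
  have g_meas[measurable]: "g \<in> borel_measurable borel" using borel_measurable_integrable[OF g] by simp
  have "integrable (distr (?S \<Otimes>\<^sub>M lborel) borel ?q) g"
    using g by (simp add: distr_strip_lines[OF v])
  then have "integrable (?S \<Otimes>\<^sub>M lborel) (\<lambda>z. g (?q z))"
    by (rule integrable_distr[OF q])
  then have "(LINT x|?S. LINT t|lborel. g (x + t *\<^sub>R v)) = (LINT z|(?S \<Otimes>\<^sub>M lborel). g (?q z))"
    using P.integral_fst'[of "\<lambda>z. g (?q z)"] by simp
  also have "\<dots> = (LINT x|distr (?S \<Otimes>\<^sub>M lborel) borel ?q. g x)"
    by (rule integral_distr[OF q, symmetric]) simp
  finally show ?thesis by (simp add: distr_strip_lines[OF v])
qed

lemma integral_strip_oblique_projection: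
  fixes F :: "'a::euclidean_space set" and h :: "'a \<Rightarrow> real"
  assumes "aff_dim F = int DIM('a) - 1" "x\<^sub>1 \<in> F"
    and "norm \<nu> = 1" "\<And>x y. x \<in> F \<Longrightarrow> y \<in> F \<Longrightarrow> \<nu> \<bullet> (x - y) = 0"
    and "norm v = 1" "\<nu> \<bullet> v \<noteq> 0" and h[measurable]: "h \<in> borel_measurable borel"
  shows "(LINT x|restrict_space lborel (strip v). h (oblique_projection v \<nu> x\<^sub>1 x))
    = \<bar>\<nu> \<bullet> v\<bar> * (LINT x|affine_lborel F. h x)"
proof -
  have [measurable]: "oblique_projection v \<nu> x\<^sub>1 \<in> restrict_space lborel (strip v) \<rightarrow>\<^sub>M borel"
    by (intro measurable_restrict_space1) simp
  have "(LINT x|restrict_space lborel (strip v). h (oblique_projection v \<nu> x\<^sub>1 x))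
    = (LINT x|distr (restrict_space lborel (strip v)) borel (oblique_projection v \<nu> x\<^sub>1). h x)"
    by (rule integral_distr[symmetric]) measurable
  also have "\<dots> = (LINT x|density (affine_lborel F) (\<lambda>_. ennreal \<bar>\<nu> \<bullet> v\<bar>). h x)"
    using distr_strip_oblique_projection[OF assms(1-6)] by simp
  also have "\<dots> = \<bar>\<nu> \<bullet> v\<bar> * (LINT x|affine_lborel F. h x)"
    by (subst integral_density) (auto cong: measurable_cong_sets simp: sets_affine_lborel)
  finally show ?thesis .
qed

section \<open>Lines crossing the boundary of an element\<close>

text \<open>
  The union of the lines in direction $v$ through a set of codimension two still has codimension at
  least one.
\<close>

lemma negligible_line_saturation:
  fixes Z :: "'a::euclidean_space set"
  assumes "aff_dim Z \<le> int DIM('a) - 2"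
  shows "negligible {x. \<exists>t. x + t *\<^sub>R v \<in> Z}"
proof (cases "Z = {}")
  case False
  then obtain z where z: "z \<in> Z" by blast
  let ?D = "(\<lambda>x. x - z) ` Z"
  have "int (dim ?D) \<le> int DIM('a) - 2"
    using assms aff_dim_eq_dim_subtract[OF hull_inc[OF z]] by simp
  moreover have "dim (span (insert v ?D)) \<le> dim ?D + 1"
    by (simp add: dim_insert)
  ultimately have "dim (span (insert v ?D)) < DIM('a)" by linarith
  then have "negligible ((+) z ` span (insert v ?D))"
    by (intro negligible_translation negligible_lowdim)
  moreover have "{x. \<exists>t. x + t *\<^sub>R v \<in> Z} \<subseteq> (+) z ` span (insert v ?D)"
  proof clarify
    fix x t assume "x + t *\<^sub>R v \<in> Z"
    then have "x + t *\<^sub>R v - z \<in> span (insert v ?D)" by (intro span_base) auto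
    then have "(x + t *\<^sub>R v - z) - t *\<^sub>R v \<in> span (insert v ?D)"
      by (rule span_diff) (intro span_mul span_base, simp)
    then have "x - z \<in> span (insert v ?D)" by (simp add: algebra_simps)
    then show "x \<in> (+) z ` span (insert v ?D)" by (rule rev_image_eqI) simp
  qed
  ultimately show ?thesis using negligible_subset by blast
qed simp

lemma polytopal_face_compact: "polytopal_face F \<Longrightarrow> compact F"
  by (auto simp: polytopal_face_def intro: polytope_imp_compact)

text \<open>
  Each convex piece of a face spans the same hyperplane as the face. The relative interior of the piece
  is therefore contained in that of the face, and what remains is covered by the facets of the pieces.
\<close>

lemma polytopal_face_boundary:
  fixes F :: "(real^'d::finite) set"
  assumes "polytopal_face F"
  obtains \<G> where "finite \<G>" "\<And>Z. Z \<in> \<G> \<Longrightarrow> aff_dim Z \<le> int CARD('d) - 2"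
    "F - rel_interior F \<subseteq> \<Union>\<G>"
proof -
  obtain \<T> where \<T>: "finite \<T>" "F = \<Union>\<T>" and F: "aff_dim F = int CARD('d) - 1"
    and T: "\<And>T. T \<in> \<T> \<Longrightarrow> polytope T" "\<And>T. T \<in> \<T> \<Longrightarrow> aff_dim T = int CARD('d) - 1"
    using assms unfolding polytopal_face_def by blast
  define \<G> where "\<G> = (\<Union>T\<in>\<T>. {Z. Z facet_of T})"
  have "finite \<G>"
    unfolding \<G>_def using \<T>(1) T(1) by (auto intro!: finite_polyhedron_facets polytope_imp_polyhedron)
  moreover have "aff_dim Z \<le> int CARD('d) - 2" if "Z \<in> \<G>" for Z
    using that T(2) by (auto simp: \<G>_def facet_of_def)
  moreover have "F - rel_interior F \<subseteq> \<Union>\<G>"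
  proof
    fix y assume y: "y \<in> F - rel_interior F"
    then obtain S where S: "S \<in> \<T>" "y \<in> S" using \<T>(2) by blast
    have "S \<subseteq> F" using S \<T>(2) by blast
    moreover have "affine hull S = affine hull F"
    proof (rule affine_dim_equal)
      show "affine hull S \<noteq> {}" using S(2) hull_subset by fastforce
      show "affine hull S \<subseteq> affine hull F" using \<open>S \<subseteq> F\<close> by (rule hull_mono)
      show "aff_dim (affine hull S) = aff_dim (affine hull F)" using F T(2)[OF S(1)] by simp
    qed auto
    ultimately have "rel_interior S \<subseteq> rel_interior F" by (rule subset_rel_interior)
    then have "y \<in> rel_frontier S"
      using y S closure_subset[of S] by (auto simp: rel_frontier_def)
    then show "y \<in> \<Union>\<G>"
      using S(1) rel_frontier_of_polyhedron[OF polytope_imp_polyhedron[OF T(1)[OF S(1)]]]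
      by (auto simp: \<G>_def)
  qed
  ultimately show ?thesis by (rule that)
qed

definition transversal_line ::
    "(real^'d::finite) set set \<Rightarrow> ((real^'d) set \<Rightarrow> real^'d) \<Rightarrow> real^'d \<Rightarrow> real^'d \<Rightarrow> bool" where
  "transversal_line \<F> \<nu> v x \<longleftrightarrow>
     (\<forall>F\<in>\<F>. \<forall>t. x + t *\<^sub>R v \<in> F \<longrightarrow> x + t *\<^sub>R v \<in> rel_interior F \<and> \<nu> F \<bullet> v \<noteq> 0)"

text \<open>
  The exceptional lines either pass through the relative boundary of a face, which has codimension two,
  or lie in the hyperplane of a face that is parallel to $v$.
\<close>

lemma AE_transversal_line:
  fixes \<Omega> :: "(real^'d::finite) set"
  assumes el: "polytopal_element \<Omega> \<F> \<nu>"
  shows "AE x in lborel. transversal_line \<F> \<nu> v x"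
proof -
  have fin: "finite \<F>" using el by (simp add: polytopal_element_def)
  have "AE x in lborel. \<forall>t. x + t *\<^sub>R v \<in> F \<longrightarrow> x + t *\<^sub>R v \<in> rel_interior F \<and> \<nu> F \<bullet> v \<noteq> 0"
    if F: "F \<in> \<F>" for F
  proof -
    have face: "polytopal_face F" and norm: "norm (\<nu> F) = 1"
      and orth: "\<And>x y. x \<in> F \<Longrightarrow> y \<in> F \<Longrightarrow> \<nu> F \<bullet> (x - y) = 0"
      using el F by (auto simp: polytopal_element_def)
    obtain \<G> where \<G>: "finite \<G>" "\<And>Z. Z \<in> \<G> \<Longrightarrow> aff_dim Z \<le> int CARD('d) - 2"
      "F - rel_interior F \<subseteq> \<Union>\<G>"
      using polytopal_face_boundary[OF face] by blast
    obtain a where a: "a \<in> F" using face by (auto simp: polytopal_face_def)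
    \<comment> \<open>the second part contains every line in direction \<open>v\<close> that meets a face parallel to \<open>v\<close>\<close>
    define N where "N = (\<Union>Z\<in>\<G>. {x. \<exists>t. x + t *\<^sub>R v \<in> Z}) \<union>
      (if \<nu> F \<bullet> v = 0 then {x. \<nu> F \<bullet> x = \<nu> F \<bullet> a} else {})"
    have "negligible N"
      unfolding N_def using \<G>(1,2) norm
      by (auto intro!: negligible_Un negligible_Union negligible_line_saturation negligible_hyperplane)
    then have "AE x in lebesgue. x \<notin> N"
      using AE_not_in[of N lebesgue] by (simp add: negligible_iff_null_sets)
    then have "AE x in lborel. x \<notin> N" by (simp add: AE_completion_iff)
    then show ?thesis
    proof eventually_elim
      case (elim x)
      show ?case
      proof (intro allI impI)
        fix t assume t: "x + t *\<^sub>R v \<in> F"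
        have "\<nu> F \<bullet> x + t * (\<nu> F \<bullet> v) = \<nu> F \<bullet> a"
          using orth[OF t a] by (simp add: inner_diff_right inner_add_right)
        then have "\<nu> F \<bullet> v \<noteq> 0" using elim by (auto simp: N_def)
        moreover have "x + t *\<^sub>R v \<in> rel_interior F"
          using elim t \<G>(3) by (auto simp: N_def)
        ultimately show "x + t *\<^sub>R v \<in> rel_interior F \<and> \<nu> F \<bullet> v \<noteq> 0" by blast
      qed
    qed
  qed
  then show ?thesis
    unfolding transversal_line_def using fin by (simp add: AE_finite_all)
qed

text \<open>
  Near $y$ the boundary of $\Omega$ consists of $F$ alone. The two open half balls at $y$, cut by the
  hyperplane of $F$, are connected and avoid the boundary, so each of them lies entirely inside or
  entirely outside of $\Omega$. The condition on the normal decides which, and $v$ points into one of them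
  according to the sign of $\nu_F \cdot v$.
\<close>

lemma crossing_direction:
  fixes \<Omega> :: "(real^'d::finite) set"
  assumes el: "polytopal_element \<Omega> \<F> \<nu>" and F: "F \<in> \<F>"
    and y: "y \<in> rel_interior F" "\<And>F'. F' \<in> \<F> \<Longrightarrow> y \<in> F' \<Longrightarrow> y \<in> rel_interior F'"
    and v: "norm v = 1" and c: "\<nu> F \<bullet> v \<noteq> 0"
  shows "\<exists>\<epsilon>>0. \<forall>t. 0 < t \<and> t < \<epsilon> \<longrightarrow>
    y - (sgn (\<nu> F \<bullet> v) * t) *\<^sub>R v \<in> \<Omega> \<and> y + (sgn (\<nu> F \<bullet> v) * t) *\<^sub>R v \<notin> \<Omega>"
proof -
  have fin: "finite \<F>" and frontier: "frontier \<Omega> = \<Union>\<F>"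
    and faces: "\<And>F. F \<in> \<F> \<Longrightarrow> polytopal_face F"
    and disj: "pairwise (\<lambda>F F'. rel_interior F \<inter> rel_interior F' = {}) \<F>"
    and norm: "norm (\<nu> F) = 1"
    and orth: "\<And>x y. x \<in> F \<Longrightarrow> y \<in> F \<Longrightarrow> \<nu> F \<bullet> (x - y) = 0"
    using el F unfolding polytopal_element_def by blast+
  have sides: "\<exists>\<epsilon>>0. \<forall>t. 0 < t \<and> t < \<epsilon> \<longrightarrow> y + t *\<^sub>R \<nu> F \<notin> \<Omega> \<and> y - t *\<^sub>R \<nu> F \<in> interior \<Omega>"
    using el F y(1) unfolding polytopal_element_def by blast
  have y_F: "y \<in> F" using y(1) rel_interior_subset by blast
  have "y \<notin> F'" if "F' \<in> \<F> - {F}" for F'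
  proof
    assume "y \<in> F'"
    then have "y \<in> rel_interior F \<inter> rel_interior F'" using y that by blast
    moreover have "rel_interior F \<inter> rel_interior F' = {}"
      using pairwiseD[OF disj F, of F'] that by blast
    ultimately show False by blast
  qed
  then have "y \<in> - \<Union>(\<F> - {F})" by blast
  moreover have "closed (\<Union>(\<F> - {F}))"
    using fin faces by (intro closed_Union) (auto intro: compact_imp_closed polytopal_face_compact)
  ultimately obtain r where r: "r > 0" and "ball y r \<subseteq> - \<Union>(\<F> - {F})"
    using open_contains_ball_eq[of "- \<Union>(\<F> - {F})" y] by (auto simp only: open_Compl)
  then have ball: "x \<notin> F'" if "F' \<in> \<F>" "F' \<noteq> F" "x \<in> ball y r" for x F'
    using that by blast
  \<comment> \<open>\<open>P 1\<close> is the half ball on the side of the normal, \<open>P (-1)\<close> the opposite one\<close>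
  define P where "P s = ball y r \<inter> {x. 0 < s * (\<nu> F \<bullet> (x - y))}" for s
  have no_frontier: "P s \<inter> frontier \<Omega> = {}" for s
  proof -
    have "x \<notin> F'" if "x \<in> P s" "F' \<in> \<F>" for x F'
    proof (cases "F' = F")
      case True
      show ?thesis
      proof
        assume "x \<in> F'"
        then have "\<nu> F \<bullet> (x - y) = 0" using True orth y_F by blast
        then show False using that(1) by (simp add: P_def)
      qed
    next
      case False
      then show ?thesis using ball[OF that(2)] that(1) by (simp add: P_def)
    qed
    then show ?thesis unfolding frontier by blast
  qed
  have conn: "connected (P s)" for s
  proof -
    have "{x. 0 < s * (\<nu> F \<bullet> (x - y))} = {x. (s *\<^sub>R \<nu> F) \<bullet> x > (s *\<^sub>R \<nu> F) \<bullet> y}"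
      by (simp add: inner_diff_right right_diff_distrib)
    then show ?thesis unfolding P_def
      by (simp only: convex_connected convex_Int convex_halfspace_gt convex_ball)
  qed
  obtain \<epsilon> where \<epsilon>: "\<epsilon> > 0"
    and out: "\<And>t. 0 < t \<Longrightarrow> t < \<epsilon> \<Longrightarrow> y + t *\<^sub>R \<nu> F \<notin> \<Omega>"
    and inn: "\<And>t. 0 < t \<Longrightarrow> t < \<epsilon> \<Longrightarrow> y - t *\<^sub>R \<nu> F \<in> \<Omega>"
    using sides interior_subset by blast
  define t\<^sub>0 where "t\<^sub>0 = min \<epsilon> r / 2"
  have t\<^sub>0: "0 < t\<^sub>0" "t\<^sub>0 < \<epsilon>" "t\<^sub>0 < r" using \<epsilon> r by (auto simp: t\<^sub>0_def min_def)
  have "\<nu> F \<bullet> \<nu> F = 1" using norm by (simp flip: norm_eq_1)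
  then have "y + t\<^sub>0 *\<^sub>R \<nu> F \<in> P 1" "y - t\<^sub>0 *\<^sub>R \<nu> F \<in> P (-1)"
    using t\<^sub>0 norm by (auto simp: P_def dist_norm)
  note t\<^sub>0_P = this
  have outside: "P 1 \<inter> \<Omega> = {}"
    using connected_Int_frontier[OF conn[of 1], of \<Omega>] no_frontier[of 1] out[OF t\<^sub>0(1,2)] t\<^sub>0_P(1)
    by blast
  have inside: "P (-1) \<subseteq> \<Omega>"
    using connected_Int_frontier[OF conn[of "-1"], of \<Omega>] no_frontier[of "-1"] inn[OF t\<^sub>0(1,2)] t\<^sub>0_P(2)
    by blast
  show ?thesis
  proof (intro exI[of _ r] conjI allI impI r)
    fix t assume t: "0 < t \<and> t < r"
    have "sgn (\<nu> F \<bullet> v) * t * (\<nu> F \<bullet> v) = t * \<bar>\<nu> F \<bullet> v\<bar>"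
      by (simp add: abs_sgn)
    moreover have "t * \<bar>\<nu> F \<bullet> v\<bar> > 0" using t c by simp
    ultimately have *: "sgn (\<nu> F \<bullet> v) * t * (\<nu> F \<bullet> v) > 0" by (simp only:)
    have **: "\<bar>sgn (\<nu> F \<bullet> v) * t\<bar> < r"
      using t c by (simp add: abs_mult abs_sgn_eq)
    have "y + (sgn (\<nu> F \<bullet> v) * t) *\<^sub>R v \<in> P 1" "y - (sgn (\<nu> F \<bullet> v) * t) *\<^sub>R v \<in> P (-1)"
      using * ** v by (auto simp: P_def dist_norm)
    then show "y - (sgn (\<nu> F \<bullet> v) * t) *\<^sub>R v \<in> \<Omega>" "y + (sgn (\<nu> F \<bullet> v) * t) *\<^sub>R v \<notin> \<Omega>"
      using outside inside by blast+
  qed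
qed

section \<open>The divergence theorem on polytopal elements\<close>

text \<open>
  On a transversal line, every boundary point of $\Omega$ lies on exactly one face, since distinct faces
  have disjoint relative interiors; it is the projection of $x$ along $v$ to the hyperplane of that face.
\<close>

lemma line_integral_over_element:
  fixes \<Omega> :: "(real^'d::finite) set" and f f' :: "real^'d \<Rightarrow> real"
  assumes el: "polytopal_element \<Omega> \<F> \<nu>" and v: "norm v = 1"
    and f: "\<And>x. ((\<lambda>t. f (x + t *\<^sub>R v)) has_real_derivative f' x) (at 0)"
    and cont: "continuous_on UNIV f'"
    and a: "\<And>F. F \<in> \<F> \<Longrightarrow> a F \<in> F"
    and x: "transversal_line \<F> \<nu> v x"
  shows "(LINT t|lborel. indicator \<Omega> (x + t *\<^sub>R v) * f' (x + t *\<^sub>R v)) =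
    (\<Sum>F | F \<in> \<F> \<and> \<nu> F \<bullet> v \<noteq> 0. sgn (\<nu> F \<bullet> v) *
      (indicator F (oblique_projection v (\<nu> F) (a F) x) * f (oblique_projection v (\<nu> F) (a F) x)))"
proof -
  have fin: "finite \<F>" and frontier: "frontier \<Omega> = \<Union>\<F>" and compact: "compact \<Omega>"
    and disj: "pairwise (\<lambda>F F'. rel_interior F \<inter> rel_interior F' = {}) \<F>"
    using el unfolding polytopal_element_def by blast+
  have orth: "\<nu> F \<bullet> (x - y) = 0" if "F \<in> \<F>" "x \<in> F" "y \<in> F" for F x y
    using el that unfolding polytopal_element_def by blast
  have x_good: "x + t *\<^sub>R v \<in> rel_interior F" "\<nu> F \<bullet> v \<noteq> 0" if "F \<in> \<F>" "x + t *\<^sub>R v \<in> F" for F t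
    using x that unfolding transversal_line_def by blast+
  define \<tau> where "\<tau> F = - (\<nu> F \<bullet> (x - a F) / (\<nu> F \<bullet> v))" for F
  define \<gamma> where "\<gamma> t = x + t *\<^sub>R v" for t
  have proj: "oblique_projection v (\<nu> F) (a F) x = \<gamma> (\<tau> F)" for F
    by (simp add: oblique_projection_def \<tau>_def \<gamma>_def)
  define I where "I = {F \<in> \<F>. \<nu> F \<bullet> v \<noteq> 0 \<and> \<gamma> (\<tau> F) \<in> F}"
  define E where "E = {t. \<gamma> t \<in> \<Omega>}"
  have fin_I: "finite I" using fin by (simp add: I_def)
  have hit: "F \<in> I \<and> t = \<tau> F" if "F \<in> \<F>" "\<gamma> t \<in> F" for F t
  proof -
    have c: "\<nu> F \<bullet> v \<noteq> 0" using x_good(2)[OF that(1)] that(2) by (simp add: \<gamma>_def)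
    have "\<nu> F \<bullet> (\<gamma> t - a F) = 0" using orth[OF that a[OF that(1)]] .
    then have "\<nu> F \<bullet> (x - a F) + t * (\<nu> F \<bullet> v) = 0"
      by (simp add: \<gamma>_def inner_diff_right inner_add_right)
    then have "t = \<tau> F" using c by (simp add: \<tau>_def field_simps)
    then show ?thesis using c that by (simp add: I_def)
  qed
  have cont_\<gamma>: "continuous_on UNIV \<gamma>" unfolding \<gamma>_def[abs_def] by (intro continuous_intros)
  have "(LINT t|lborel. indicator E t * f' (\<gamma> t)) = (\<Sum>F\<in>I. sgn (\<nu> F \<bullet> v) * f (\<gamma> (\<tau> F)))"
  proof (rule integral_derivative_over_alternating_set[where \<phi>="\<lambda>t. f (\<gamma> t)", OF fin_I])
    show "inj_on \<tau> I"
    proof (rule inj_onI, rule ccontr)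
      fix F F' assume F: "F \<in> I" "F' \<in> I" "\<tau> F = \<tau> F'" and neq: "F \<noteq> F'"
      then have "\<gamma> (\<tau> F) \<in> rel_interior F \<inter> rel_interior F'"
        using x_good(1)[of F "\<tau> F"] x_good(1)[of F' "\<tau> F"] by (simp add: I_def \<gamma>_def)
      moreover have "rel_interior F \<inter> rel_interior F' = {}"
        using pairwiseD[OF disj, of F F'] F neq by (simp add: I_def)
      ultimately show False by blast
    qed
    show "compact E"
    proof -
      have "closed E"
        using closed_vimage[OF compact_imp_closed[OF compact] cont_\<gamma>] by (simp add: E_def vimage_def)
      moreover have "bounded E"
      proof -
        obtain K where K: "\<And>y. y \<in> \<Omega> \<Longrightarrow> norm y \<le> K"
          using compact_imp_bounded[OF compact] by (auto simp: bounded_iff)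
        have "norm t \<le> K + norm x" if "t \<in> E" for t
        proof -
          have "norm t = norm (\<gamma> t - x)" by (simp add: \<gamma>_def v)
          also have "\<dots> \<le> norm (\<gamma> t) + norm x" by (rule norm_triangle_ineq4)
          also have "\<dots> \<le> K + norm x" using K that by (simp add: E_def)
          finally show ?thesis .
        qed
        then show ?thesis unfolding bounded_iff by blast
      qed
      ultimately show ?thesis by (simp add: compact_eq_bounded_closed)
    qed
    show "((\<lambda>t. f (\<gamma> t)) has_real_derivative f' (\<gamma> t)) (at t)" for t
      unfolding \<gamma>_def by (rule directional_derivative_along_line, rule f)
    show "continuous_on UNIV (\<lambda>t. f' (\<gamma> t))"
      by (rule continuous_on_compose2[OF cont cont_\<gamma>]) simp
    show "\<forall>\<^sub>F s in nhds t. (s \<in> E) = (t \<in> E)" if "t \<notin> \<tau> ` I" for t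
    proof -
      have nf: "\<gamma> t \<notin> frontier \<Omega>" using that hit unfolding frontier by blast
      show ?thesis
      proof (cases "\<gamma> t \<in> \<Omega>")
        case True
        then have "\<gamma> t \<in> interior \<Omega>"
          using nf closure_subset by (auto simp: frontier_def)
        then have "\<forall>\<^sub>F s in nhds t. s \<in> \<gamma> -` interior \<Omega>"
          by (intro eventually_nhds_in_open open_vimage cont_\<gamma>) auto
        then show ?thesis
          by eventually_elim (use True interior_subset in \<open>auto simp: E_def\<close>)
      next
        case False
        then have "\<forall>\<^sub>F s in nhds t. s \<in> \<gamma> -` (- \<Omega>)"
          using compact_imp_closed[OF compact]
          by (intro eventually_nhds_in_open open_vimage cont_\<gamma>) auto
        then show ?thesis
          by eventually_elim (use False in \<open>auto simp: E_def\<close>)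
      qed
    qed
    fix F assume F: "F \<in> I"
    then have F_mem: "F \<in> \<F>" "\<gamma> (\<tau> F) \<in> F" "\<nu> F \<bullet> v \<noteq> 0" by (auto simp: I_def)
    show "sgn (\<nu> F \<bullet> v) = 1 \<or> sgn (\<nu> F \<bullet> v) = - 1" using F_mem by (simp add: sgn_if)
    have "F \<subseteq> \<Omega>" using F_mem(1) frontier frontier_subset_closed[OF compact_imp_closed[OF compact]] by blast
    then show "\<tau> F \<in> E" using F_mem(2) by (auto simp: E_def)
    have ri: "\<gamma> (\<tau> F) \<in> rel_interior F'" if "F' \<in> \<F>" "\<gamma> (\<tau> F) \<in> F'" for F'
      using x_good(1)[OF that(1)] that(2) by (simp add: \<gamma>_def)
    have shift: "\<gamma> (t + s) = \<gamma> t + s *\<^sub>R v" "\<gamma> (t - s) = \<gamma> t - s *\<^sub>R v" for t s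
      by (simp_all add: \<gamma>_def algebra_simps)
    show "\<exists>\<epsilon>>0. \<forall>t. 0 < t \<and> t < \<epsilon> \<longrightarrow>
      \<tau> F - sgn (\<nu> F \<bullet> v) * t \<in> E \<and> \<tau> F + sgn (\<nu> F \<bullet> v) * t \<notin> E"
      unfolding E_def mem_Collect_eq shift
      by (rule crossing_direction[OF el F_mem(1) ri[OF F_mem(1,2)] ri v F_mem(3)])
  qed
  also have "\<dots> = (\<Sum>F | F \<in> \<F> \<and> \<nu> F \<bullet> v \<noteq> 0. sgn (\<nu> F \<bullet> v) * (indicator F (\<gamma> (\<tau> F)) * f (\<gamma> (\<tau> F))))"
    by (rule sum.mono_neutral_cong_left) (use fin in \<open>auto simp: I_def indicator_def\<close>)
  finally show ?thesis by (simp add: proj E_def \<gamma>_def indicator_def)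
qed

text \<open>
  The integrand is bounded, and a point of the strip whose projection lies in the bounded set $F$ is
  itself within bounded distance of the origin.
\<close>

lemma integrable_oblique_projection:
  fixes F :: "'a::euclidean_space set" and f :: "'a \<Rightarrow> real"
  assumes F: "compact F" and f: "continuous_on UNIV f" and v: "norm v = 1"
  shows "integrable (restrict_space lborel (strip v))
    (\<lambda>x. indicator F (oblique_projection v \<nu> a x) * f (oblique_projection v \<nu> a x))"
proof -
  let ?\<pi> = "oblique_projection v \<nu> a" and ?S = "restrict_space lborel (strip v)"
  have [measurable]: "f \<in> borel_measurable borel" using f by (rule borel_measurable_continuous_onI)
  have [measurable]: "F \<in> sets borel" using F by (simp add: borel_compact)
  have "compact (f ` F)" using F continuous_on_subset[OF f] by (intro compact_continuous_image) auto
  then obtain C where C: "0 < C" "\<And>y. y \<in> F \<Longrightarrow> norm (f y) \<le> C"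
    using compact_imp_bounded[of "f ` F"] by (auto simp: bounded_pos)
  obtain K where K: "\<And>y. y \<in> F \<Longrightarrow> norm y \<le> K"
    using compact_imp_bounded[OF F] by (auto simp: bounded_iff)
  let ?A = "strip v \<inter> cball 0 (2 * K + 1)"
  have out: "?\<pi> x \<notin> F" if "x \<in> strip v" "x \<notin> ?A" for x
  proof
    assume mem: "?\<pi> x \<in> F"
    define s where "s = \<nu> \<bullet> (x - a) / (\<nu> \<bullet> v)"
    have x: "x = ?\<pi> x + s *\<^sub>R v" by (simp add: oblique_projection_def s_def)
    have "v \<bullet> x = v \<bullet> ?\<pi> x + s"
      using v by (subst x) (simp add: inner_add_right flip: norm_eq_1)
    moreover have "\<bar>v \<bullet> ?\<pi> x\<bar> \<le> norm (?\<pi> x)"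
      using Cauchy_Schwarz_ineq2[of v "?\<pi> x"] v by simp
    moreover have "0 \<le> v \<bullet> x" "v \<bullet> x < 1" using that(1) by (auto simp: strip_def)
    ultimately have "\<bar>s\<bar> \<le> norm (?\<pi> x) + 1" by linarith
    moreover have "norm x \<le> norm (?\<pi> x) + \<bar>s\<bar>"
      using norm_triangle_ineq[of "?\<pi> x" "s *\<^sub>R v"] v x by simp
    ultimately have "norm x \<le> 2 * K + 1" using K[OF mem] by linarith
    then show False using that by simp
  qed
  show ?thesis
  proof (rule integrableI_bounded_set[of ?A _ _ C])
    show "?A \<in> sets ?S" by (auto simp: sets_restrict_space)
    have "emeasure ?S ?A = emeasure lborel ?A" by (subst emeasure_restrict_space) auto
    also have "\<dots> \<le> emeasure lborel (cball (0::'a) (2 * K + 1))" by (rule emeasure_mono) auto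
    also have "\<dots> < \<infinity>" using emeasure_lborel_cball_finite[of "0::'a" "2 * K + 1"] by simp
    finally show "emeasure ?S ?A < \<infinity>" .
    show "(\<lambda>x. indicator F (?\<pi> x) * f (?\<pi> x)) \<in> borel_measurable ?S"
      by (rule measurable_restrict_space1) measurable
    show "AE x in ?S. x \<in> ?A \<longrightarrow> norm (indicator F (?\<pi> x) * f (?\<pi> x)) \<le> C"
      by (rule AE_I2) (use C in \<open>auto simp: indicator_def\<close>)
    show "AE x in ?S. x \<notin> ?A \<longrightarrow> indicator F (?\<pi> x) * f (?\<pi> x) = 0"
      by (rule AE_I2) (use out in \<open>auto simp: space_restrict_space\<close>)
  qed
qed

lemma divergence_polytopal_element:
  fixes \<Omega> :: "(real^'d::finite) set" and f f' :: "real^'d \<Rightarrow> real"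
  assumes el: "polytopal_element \<Omega> \<F> \<nu>" and v: "norm v = 1"
    and f: "\<And>x. ((\<lambda>t. f (x + t *\<^sub>R v)) has_real_derivative f' x) (at 0)"
    and cont: "continuous_on UNIV f" "continuous_on UNIV f'"
  shows "integral \<Omega> f' = (\<Sum>F\<in>\<F>. (\<nu> F \<bullet> v) * face_integral F f)"
proof -
  have fin: "finite \<F>" and compact: "compact \<Omega>" and face: "\<And>F. F \<in> \<F> \<Longrightarrow> polytopal_face F"
    and norm: "\<And>F. F \<in> \<F> \<Longrightarrow> norm (\<nu> F) = 1"
    using el unfolding polytopal_element_def by blast+
  have orth: "\<nu> F \<bullet> (x - y) = 0" if "F \<in> \<F>" "x \<in> F" "y \<in> F" for F x y
    using el that unfolding polytopal_element_def by blast
  have "\<forall>F\<in>\<F>. \<exists>a. a \<in> F" using face by (auto simp: polytopal_face_def)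
  then obtain a where a: "\<And>F. F \<in> \<F> \<Longrightarrow> a F \<in> F" by metis
  let ?S = "restrict_space lborel (strip v)"
  let ?g = "\<lambda>x. indicator \<Omega> x * f' x"
  let ?h = "\<lambda>F x. indicator F x * f x"
  let ?\<pi> = "\<lambda>F. oblique_projection v (\<nu> F) (a F)"
  let ?\<F>' = "{F \<in> \<F>. \<nu> F \<bullet> v \<noteq> 0}"
  have [measurable]: "f \<in> borel_measurable borel" "f' \<in> borel_measurable borel"
    using cont by (auto intro: borel_measurable_continuous_onI)
  have F_borel[measurable]: "F \<in> sets borel" if "F \<in> \<F>" for F
    using polytopal_face_compact[OF face[OF that]] by (rule borel_compact)
  have int: "integrable lborel ?g"
    using borel_integrable_compact[OF compact continuous_on_subset[OF cont(2)]]
    by (simp add: indicator_def)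
  have [measurable]: "\<Omega> \<in> sets borel" using compact by (rule borel_compact)
  have int_h: "integrable ?S (\<lambda>x. ?h F (?\<pi> F x))" if "F \<in> \<F>" for F
    by (rule integrable_oblique_projection[OF polytopal_face_compact[OF face[OF that]] cont(1) v])
  have "integral \<Omega> f' = (LINT x|lborel. ?g x)"
    using set_borel_integral_eq_integral(2)[of \<Omega> f'] int
    by (simp add: set_integrable_def set_lebesgue_integral_def)
  also have "\<dots> = (LINT x|?S. LINT t|lborel. ?g (x + t *\<^sub>R v))"
    by (rule integral_over_strip_of_line_integrals[OF v int])
  also have "\<dots> = (LINT x|?S. (\<Sum>F\<in>?\<F>'. sgn (\<nu> F \<bullet> v) * ?h F (?\<pi> F x)))"
  proof (rule integral_cong_AE)
    have "(\<lambda>z. ?g (case z of (x, t) \<Rightarrow> x + t *\<^sub>R v)) \<in> borel_measurable (?S \<Otimes>\<^sub>M lborel)"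
      by (rule measurable_compose[OF strip_line_measurable]) measurable
    then have "(\<lambda>(x, t). ?g (x + t *\<^sub>R v)) \<in> borel_measurable (?S \<Otimes>\<^sub>M lborel)"
      by (simp add: case_prod_beta)
    then show "(\<lambda>x. LINT t|lborel. ?g (x + t *\<^sub>R v)) \<in> borel_measurable ?S"
      by (rule lborel.borel_measurable_lebesgue_integral)
    show "(\<lambda>x. \<Sum>F\<in>?\<F>'. sgn (\<nu> F \<bullet> v) * ?h F (?\<pi> F x)) \<in> borel_measurable ?S"
      by (rule borel_measurable_integrable, rule Bochner_Integration.integrable_sum,
          rule integrable_mult_right) (use int_h in auto)
    have "AE x in ?S. transversal_line \<F> \<nu> v x"
      using AE_transversal_line[OF el, of v] by (auto simp: AE_restrict_space_iff elim: eventually_mono)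
    then show "AE x in ?S. (LINT t|lborel. ?g (x + t *\<^sub>R v)) = (\<Sum>F\<in>?\<F>'. sgn (\<nu> F \<bullet> v) * ?h F (?\<pi> F x))"
      by eventually_elim (rule line_integral_over_element[OF el v f cont(2) a])
  qed
  also have "\<dots> = (\<Sum>F\<in>?\<F>'. sgn (\<nu> F \<bullet> v) * (LINT x|?S. ?h F (?\<pi> F x)))"
    using int_h by (subst Bochner_Integration.integral_sum) auto
  also have "\<dots> = (\<Sum>F\<in>?\<F>'. (\<nu> F \<bullet> v) * face_integral F f)"
  proof (rule sum.cong[OF refl])
    fix F assume "F \<in> ?\<F>'"
    then have F: "F \<in> \<F>" and c: "\<nu> F \<bullet> v \<noteq> 0" by auto
    have dim: "aff_dim F = int DIM(real^'d) - 1" using face[OF F] by (simp add: polytopal_face_def)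
    have "(LINT x|?S. ?h F (?\<pi> F x)) = \<bar>\<nu> F \<bullet> v\<bar> * (LINT x|affine_lborel F. ?h F x)"
      by (rule integral_strip_oblique_projection[OF dim a[OF F] norm[OF F] orth[OF F] v c])
         (use F in measurable)
    also have "(LINT x|affine_lborel F. ?h F x) = face_integral F f"
      by (simp add: face_integral_def set_lebesgue_integral_def)
    finally have "sgn (\<nu> F \<bullet> v) * (LINT x|?S. ?h F (?\<pi> F x)) =
        (sgn (\<nu> F \<bullet> v) * \<bar>\<nu> F \<bullet> v\<bar>) * face_integral F f"
      by (simp only: mult.assoc)
    then show "sgn (\<nu> F \<bullet> v) * (LINT x|?S. ?h F (?\<pi> F x)) = (\<nu> F \<bullet> v) * face_integral F f"
      by (simp only: mult_sgn_abs)
  qed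
  also have "\<dots> = (\<Sum>F\<in>\<F>. (\<nu> F \<bullet> v) * face_integral F f)"
    using fin by (intro sum.mono_neutral_left) auto
  finally show ?thesis .
qed

section \<open>Integration by parts for the discrete operators\<close>

lemma line_derivative_poly_space:
  assumes "f \<in> poly_space q"
  shows "((\<lambda>t. f (x + t *\<^sub>R axis k 1)) has_real_derivative partial_deriv k f x) (at 0)"
  unfolding partial_deriv_def
  by (rule has_derivative_imp_directional)
     (use poly_space_differentiable[OF assms] frechet_derivative_works in blast)

lemma divergence_poly_space:
  assumes el: "polytopal_element \<Omega> \<F> \<nu>" and f: "f \<in> poly_space (Suc q)"
  shows "integral \<Omega> (partial_deriv k f) = (\<Sum>F\<in>\<F>. \<nu> F $ k * face_integral F f)"
  using divergence_polytopal_element[OF el norm_axis_1[of k] line_derivative_poly_space[OF f]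
      continuous_on_poly_space[OF f] continuous_on_poly_space[OF partial_deriv_poly_space[OF f]]]
  by (simp add: inner_axis)

lemma partial_deriv_mult:
  assumes "f differentiable (at x)" "g differentiable (at x)"
  shows "partial_deriv k (\<lambda>x. f x * g x) x = f x * partial_deriv k g x + partial_deriv k f x * (g x :: real)"
  using has_derivative_mult[OF assms[unfolded frechet_derivative_works]]
  by (subst partial_deriv_unique) (auto simp: partial_deriv_def)

lemma quad_add: "quad Q (\<lambda>x. f x + g x) = quad Q f + quad Q g"
  by (simp add: quad_def scaleR_add_right sum.distrib)

lemma quad_nth: "quad Q f $ i = quad Q (\<lambda>x. f x $ i)"
  by (simp add: quad_def)

lemma quad_mult_left: "quad Q (\<lambda>x. r * f x) = r * (quad Q f :: real)"
  by (simp add: quad_def sum_distrib_left mult.left_commute)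

text \<open>
  The three volume terms are the product rule for $\partial_k(f\, y\, g)$, a polynomial of degree at most
  $3p$, while $f\, y\, g$ has degree at most $3p + 1$. So all quadratures are exact, and the divergence
  theorem applies.
\<close>

lemma quadrature_integration_by_parts:
  fixes \<Omega> :: "(real^'d::finite) set" and y f g :: "real^'d \<Rightarrow> real"
  assumes el: "polytopal_element \<Omega> \<F> \<nu>"
    and Q: "volume_quadrature \<Omega> (3 * p) Q"
    and Q\<^sub>f: "\<And>F. F \<in> \<F> \<Longrightarrow> face_quadrature F (3 * p + 1) (Q\<^sub>f F)"
    and f: "f \<in> poly_space p" and g: "g \<in> poly_space p" and y: "y \<in> poly_space (p + 1)"
  shows "quad Q (\<lambda>x. f x * y x * partial_deriv k g x) + quad Q (\<lambda>x. g x * y x * partial_deriv k f x)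
      = (\<Sum>F\<in>\<F>. quad (Q\<^sub>f F) (\<lambda>x. \<nu> F $ k * (f x * y x * g x)))
        - quad Q (\<lambda>x. f x * partial_deriv k y x * g x)"
proof -
  let ?h = "\<lambda>x. f x * y x * g x"
  have fy: "(\<lambda>x. f x * y x) \<in> poly_space (Suc (2 * p))" and gy: "(\<lambda>x. g x * y x) \<in> poly_space (Suc (2 * p))"
    using poly_space_mult[OF f y] poly_space_mult[OF g y] by (simp_all add: mult_2)
  have h: "?h \<in> poly_space (Suc (3 * p))"
    using poly_space_mult[OF fy g] by (simp add: add.commute)
  have diff: "h differentiable (at x)" if "h \<in> {f, g, y, \<lambda>x. f x * y x}" for h x
    using that f g y fy poly_space_differentiable by blast
  have deriv: "partial_deriv k ?h x = f x * y x * partial_deriv k g x + g x * y x * partial_deriv k f x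
      + f x * partial_deriv k y x * g x" for x
    using diff by (simp add: partial_deriv_mult algebra_simps)
  have "partial_deriv k ?h \<in> poly_space (3 * p)" by (rule partial_deriv_poly_space[OF h])
  then have "quad Q (partial_deriv k ?h) = integral \<Omega> (partial_deriv k ?h)"
    using Q by (simp add: volume_quadrature_def)
  also have "\<dots> = (\<Sum>F\<in>\<F>. \<nu> F $ k * face_integral F ?h)"
    by (rule divergence_poly_space[OF el h])
  also have "\<dots> = (\<Sum>F\<in>\<F>. quad (Q\<^sub>f F) (\<lambda>x. \<nu> F $ k * ?h x))"
    using Q\<^sub>f h by (intro sum.cong refl) (simp add: quad_mult_left face_quadrature_def)
  finally have "quad Q (\<lambda>x. partial_deriv k ?h x) = (\<Sum>F\<in>\<F>. quad (Q\<^sub>f F) (\<lambda>x. \<nu> F $ k * ?h x))" .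
  then show ?thesis by (simp add: deriv quad_add)
qed

lemma discrete_projection_in_poly_space:
  assumes "projection_well_defined Q q"
  shows "discrete_projection Q q f \<in> poly_space q"
  using theI'[of "is_discrete_projection Q q f"] assms
  by (auto simp: projection_well_defined_def discrete_projection_def is_discrete_projection_def)

lemma discrete_projection_cong:
  assumes "\<And>x. x \<in> fst Q \<Longrightarrow> f x = f' x"
  shows "discrete_projection Q q f = discrete_projection Q q f'"
proof -
  have "quad Q (\<lambda>x. \<psi> x * (f x - g x)) = quad Q (\<lambda>x. \<psi> x * (f' x - g x))" for \<psi> g
    unfolding quad_def using assms by (intro sum.cong) auto
  then show ?thesis by (simp add: discrete_projection_def is_discrete_projection_def)
qed

text \<open>
  The conditions that define the discrete projection refer to the projected function only through its
  values at the nodes.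
\<close>

lemma matrix_projection_symmetric:
  assumes "\<And>x. x \<in> fst Q \<Longrightarrow> symmetric_matrix (M x)"
  shows "matrix_projection Q q M x $ i $ j = matrix_projection Q q M x $ j $ i"
proof -
  have "M x $ i $ j = M x $ j $ i" if "x \<in> fst Q" for x
    using arg_cong[OF assms[OF that, unfolded symmetric_matrix_def], of "\<lambda>N. N $ j $ i"]
    by (simp add: transpose_def)
  then show ?thesis
    using discrete_projection_cong[of Q "\<lambda>y. M y $ i $ j" "\<lambda>y. M y $ j $ i"]
    by (simp add: matrix_projection_def)
qed

lemma partial_deriv_matrix_nth:
  fixes Y :: "real^'d::finite \<Rightarrow> real^'m::finite^'m"
  assumes "\<And>i j. (\<lambda>x. Y x $ i $ j) differentiable (at x)"
  shows "partial_deriv k Y x $ i $ j = partial_deriv k (\<lambda>x. Y x $ i $ j) x"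
proof -
  have "(Y has_derivative (\<lambda>h. \<chi> i j. frechet_derivative (\<lambda>x. Y x $ i $ j) (at x) h)) (at x)"
    using assms[unfolded frechet_derivative_works]
    by (subst has_derivative_componentwise_within)
       (auto simp: Basis_vec_def inner_axis)
  from partial_deriv_unique[OF this, of k] show ?thesis
    by (simp add: partial_deriv_def[of k "\<lambda>x. Y x $ i $ j"])
qed

lemma partial_deriv_basis_block:
  assumes "\<phi> \<beta> differentiable (at x)"
  shows "partial_deriv k (basis_block \<phi> \<beta>) x = partial_deriv k (\<phi> \<beta>) x *\<^sub>R mat 1"
proof -
  have "((\<lambda>x. \<phi> \<beta> x *\<^sub>R mat 1) has_derivative (\<lambda>h. frechet_derivative (\<phi> \<beta>) (at x) h *\<^sub>R mat 1)) (at x)"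
    using assms[unfolded frechet_derivative_works] by (rule has_derivative_scaleR_left)
  from partial_deriv_unique[OF this, of k] show ?thesis
    by (simp add: partial_deriv_def[of k "\<phi> \<beta>"] basis_block_def[abs_def])
qed

lemma scalar_block_product:
  fixes M :: "real^'m::finite^'m"
  shows "(transpose (basis_block \<phi> \<alpha> x) ** M ** (r *\<^sub>R mat 1)) $ i $ j = \<phi> \<alpha> x * M $ i $ j * r"
proof -
  have "transpose (basis_block \<phi> \<alpha> x) ** M ** (r *\<^sub>R mat 1) = (\<phi> \<alpha> x * r) *\<^sub>R M"
    by (simp add: basis_block_def transpose_scalar transpose_mat scalar_matrix_assoc[symmetric]
        matrix_scalar_ac mult.commute)
  then show ?thesis by (simp add: ac_simps)
qed

lemma cpg_operators_entries:
  fixes Y :: "'d::finite \<Rightarrow> real^'d \<Rightarrow> real^'m::finite^'m" and \<phi> :: "'b::finite \<Rightarrow> real^'d \<Rightarrow> real"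
  assumes \<phi>: "\<And>\<alpha>. \<phi> \<alpha> \<in> poly_space p" and Y: "\<And>k i j. (\<lambda>x. Y k x $ i $ j) \<in> poly_space q"
  shows "cpg_N Q \<phi> Y $ \<alpha> $ \<beta> $ i $ j =
      (\<Sum>k\<in>UNIV. quad Q (\<lambda>x. \<phi> \<alpha> x * Y k x $ i $ j * partial_deriv k (\<phi> \<beta>) x))"
    and "cpg_V Q \<phi> Y $ \<alpha> $ \<beta> $ i $ j =
      (\<Sum>k\<in>UNIV. quad Q (\<lambda>x. \<phi> \<alpha> x * partial_deriv k (\<lambda>x. Y k x $ i $ j) x * \<phi> \<beta> x))"
    and "cpg_B \<F> \<nu> Q\<^sub>f \<phi> Y $ \<alpha> $ \<beta> $ i $ j =
      (\<Sum>k\<in>UNIV. \<Sum>F\<in>\<F>. quad (Q\<^sub>f F) (\<lambda>x. \<nu> F $ k * (\<phi> \<alpha> x * Y k x $ i $ j * \<phi> \<beta> x)))"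
  using poly_space_differentiable[OF \<phi>] poly_space_differentiable[OF Y]
  by (simp_all add: cpg_N_def cpg_V_def cpg_B_def quad_nth partial_deriv_basis_block scalar_block_product
      partial_deriv_matrix_nth basis_block_def[of _ \<beta>])

theorem corollary5p9:
  fixes D \<U> :: "(real^'m::finite) set"
    and F :: "'d::finite \<Rightarrow> real^'m \<Rightarrow> real^'m"
    and A \<Delta>A X G :: "'d \<Rightarrow> real^'m \<Rightarrow> real^'m^'m"
    and e :: "real^'m \<Rightarrow> real"
    and g :: "'d \<Rightarrow> real^'m \<Rightarrow> real"
    and \<Omega> :: "(real^'d) set"
    and \<F> :: "(real^'d) set set"
    and \<nu> :: "(real^'d) set \<Rightarrow> real^'d"
    and p n :: nat
    and \<phi> :: "'b::finite \<Rightarrow> real^'d \<Rightarrow> real"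
    and u\<^sub>p :: "real^'d \<Rightarrow> real^'m"
    and Q Q\<^sub>h\<^sub>i :: "'d quadrature"
    and Q\<^sub>f :: "(real^'d) set \<Rightarrow> 'd quadrature"
    and Y :: "'d \<Rightarrow> real^'d \<Rightarrow> real^'m^'m"
  assumes domain: "open D" "\<U> \<subseteq> D"
    and flux_smooth: "\<And>k. smooth_on (F k) D"
    and A_def: "A = (\<lambda>k u. jacobian (F k) (at u))"
    and energy_smooth: "smooth_on e D" "\<And>k. smooth_on (g k) D"
    and energy_pair: "\<And>k u. u \<in> D \<Longrightarrow> grad e u v* A k u = grad (g k) u"
    and energy_pos: "\<And>u. u \<in> \<U> \<Longrightarrow> 0 < e u"
    and hessian_pos: "\<And>u. u \<in> \<U> \<Longrightarrow> sym_pos_def (hessian e u)"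
    and G_smooth: "\<And>k. smooth_on (G k) D"
    and G_sym: "\<And>k u. u \<in> \<U> \<Longrightarrow> symmetric_matrix (G k u)"
    and G_flux: "\<And>k u. u \<in> \<U> \<Longrightarrow> g k u = 1 / 2 * (u \<bullet> (G k u *v u))"
    and \<Delta>A_def: "\<And>k u. u \<in> \<U> \<Longrightarrow> G k u = scaled_hessian e u ** (A k u + \<Delta>A k u)"
    and element: "polytopal_element \<Omega> \<F> \<nu>"
    and basis: "orthonormal_poly_basis \<Omega> p \<phi>"
    and state: "\<And>i. (\<lambda>x. u\<^sub>p x $ i) \<in> poly_space p" "\<And>x. x \<in> \<Omega> \<Longrightarrow> u\<^sub>p x \<in> \<U>"
    and volume_quad: "volume_quadrature \<Omega> (3 * p) Q"
    and face_quad: "\<And>f. f \<in> \<F> \<Longrightarrow> face_quadrature f (3 * p + 1) (Q\<^sub>f f)"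
    and hi_quad: "n \<ge> 3 * p + 1" "volume_quadrature \<Omega> n Q\<^sub>h\<^sub>i"
    and projection: "projection_well_defined Q\<^sub>h\<^sub>i (p + 1)"
    and X_choice: "X \<in> {A, \<Delta>A}"
    and Y_def: "Y = projected_coefficient e X Q\<^sub>h\<^sub>i (p + 1) u\<^sub>p"
  shows "cpg_N Q \<phi> Y + block_transpose (cpg_N Q \<phi> Y) = cpg_B \<F> \<nu> Q\<^sub>f \<phi> Y - cpg_V Q \<phi> Y"
proof -
  have \<phi>: "\<phi> \<alpha> \<in> poly_space p" for \<alpha> using basis by (simp add: orthonormal_poly_basis_def)
  have Y_poly: "(\<lambda>x. Y k x $ i $ j) \<in> poly_space (p + 1)" for k i j
    using discrete_projection_in_poly_space[OF projection]
    by (simp add: Y_def projected_coefficient_def matrix_projection_def)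
  have A_sym: "symmetric_matrix (scaled_hessian e u ** A k u)" if u: "u \<in> \<U>" for k u
  proof -
    have "u \<in> D" using domain u by blast
    then show ?thesis
      using scaled_hessian_times_flux_jacobian_symmetric[OF domain(1) _ flux_smooth energy_smooth, of u k]
        energy_pair hessian_pos[OF u] by (simp add: A_def sym_pos_def_def)
  qed
  \<comment> \<open>the choice \<open>X = \<Delta>A\<close> reduces to \<open>A\<close>, because \<open>H ** (A + \<Delta>A)\<close> is the symmetric \<open>G\<close>\<close>
  have X_sym: "symmetric_matrix (scaled_hessian e u ** X k u)" if u: "u \<in> \<U>" for k u
  proof (cases "X = A")
    case False
    have "G k u = scaled_hessian e u ** A k u + scaled_hessian e u ** \<Delta>A k u"
      using \<Delta>A_def[OF u] by (simp add: matrix_add_ldistrib)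
    then have "scaled_hessian e u ** \<Delta>A k u = G k u - scaled_hessian e u ** A k u" by simp
    then show ?thesis
      using G_sym[OF u, of k] A_sym[OF u, of k] X_choice False
      by (simp add: symmetric_matrix_def transpose_def vec_eq_iff)
  qed (simp add: A_sym[OF u])
  have nodes: "x \<in> \<Omega>" if "x \<in> fst Q\<^sub>h\<^sub>i" for x
    using hi_quad(2) that by (auto simp: volume_quadrature_def positive_quadrature_def)
  have Y_sym: "Y k x $ j $ i = Y k x $ i $ j" for k x i j
    unfolding Y_def projected_coefficient_def
    by (rule matrix_projection_symmetric) (rule X_sym, rule state(2), rule nodes)
  note entries = cpg_operators_entries[OF \<phi> Y_poly]
  show ?thesis
  proof (simp only: vec_eq_iff, intro allI)
    fix \<alpha> \<beta> i j
    let ?y = "\<lambda>k x. Y k x $ i $ j"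
    have "(cpg_N Q \<phi> Y + block_transpose (cpg_N Q \<phi> Y)) $ \<alpha> $ \<beta> $ i $ j =
        (\<Sum>k\<in>UNIV. quad Q (\<lambda>x. \<phi> \<alpha> x * ?y k x * partial_deriv k (\<phi> \<beta>) x)
          + quad Q (\<lambda>x. \<phi> \<beta> x * ?y k x * partial_deriv k (\<phi> \<alpha>) x))"
      by (simp add: block_transpose_def transpose_def entries Y_sym[of _ _ j i] sum.distrib)
    also have "\<dots> = (\<Sum>k\<in>UNIV. (\<Sum>F\<in>\<F>. quad (Q\<^sub>f F) (\<lambda>x. \<nu> F $ k * (\<phi> \<alpha> x * ?y k x * \<phi> \<beta> x)))
          - quad Q (\<lambda>x. \<phi> \<alpha> x * partial_deriv k (?y k) x * \<phi> \<beta> x))"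
      by (intro sum.cong refl
          quadrature_integration_by_parts[OF element volume_quad face_quad \<phi> \<phi> Y_poly])
    also have "\<dots> = (cpg_B \<F> \<nu> Q\<^sub>f \<phi> Y - cpg_V Q \<phi> Y) $ \<alpha> $ \<beta> $ i $ j"
      by (simp add: entries sum_subtractf)
    finally show "(cpg_N Q \<phi> Y + block_transpose (cpg_N Q \<phi> Y)) $ \<alpha> $ \<beta> $ i $ j =
        (cpg_B \<F> \<nu> Q\<^sub>f \<phi> Y - cpg_V Q \<phi> Y) $ \<alpha> $ \<beta> $ i $ j" .
  qed
qed

end
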